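(* The operator $A$ is accretive in $L^1(\Omega)$: for all $u,v\in D(A)$ and all $\lambda>0$, $\|u-v\|_{L^1(\Omega)}\le\|u-v+\lambda(Au-Av)\|_{L^1(\Omega)}$; equivalently, there is $w\in L^\infty(\Omega)$ with $w(x)\in\mathrm{sgn}(u(x)-v(x))$ a.e. such that $\int_\Omega(Au-Av)\,w\,dx\ge0$.
   Context: Let $d\ge1$, $\Omega\subset\mathbb R^d$ a bounded smooth domain, $p\in(1,\infty)$, $s\in(0,1)$, $m>1$. $[X]^r:=|X|^{r-1}X$. $W^{s,p}_0(\Omega)=\{u\in W^{s,p}(\mathbb R^d):u=0\text{ a.e. on }\mathbb R^d\setminus\Omega\}$. The fractional $p$-Laplacian is $(-\Delta)^s_pu(x)=2\,\mathrm{p.v.}\int_{\mathbb R^d}[u(x)-u(y)]^{p-1}|x-y|^{-d-sp}dy$, acting weakly by $\langle(-\Delta)^s_pu,\varphi\rangle=\iint_{\mathbb R^{2d}}[u(x)-u(y)]^{p-1}(\varphi(x)-\varphi(y))|x-y|^{-d-sp}dxdy$. $Au=(-\Delta)^s_p[u]^m$ with $D(A)=\{u:\ [u]^m\in W^{s,p}_0(\Omega),\ (-\Delta)^s_p[u]^m\in L^1(\Omega)\}$. $\mathrm{sgn}$ denotes the multivalued sign ($\mathrm{sgn}(0)=[-1,1]$). *)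

theory Defs
  imports "HOL-Analysis.Analysis"
begin

definition spow :: "real \<Rightarrow> real \<Rightarrow> real" where
  "spow r X = \<bar>X\<bar> powr (r - 1) * X"

definition sgn_set :: "real \<Rightarrow> real set" where
  "sgn_set t = (if t > 0 then {1} else if t < 0 then {-1} else {-1..1})"

text \<open>C-infinity functions on a Euclidean space: the greatest class of everywhere
  differentiable functions closed under taking partial derivatives.\<close>
definition smooth_fun :: "('a::euclidean_space \<Rightarrow> real) \<Rightarrow> bool" where
  "smooth_fun f \<longleftrightarrow> (\<exists>S. f \<in> S \<and> (\<forall>g\<in>S. (\<forall>x. g differentiable (at x)) \<and>
       (\<forall>i\<in>Basis. (\<lambda>x. frechet_derivative g (at x) i) \<in> S)))"

definition bounded_smooth_domain :: "('a::euclidean_space) set \<Rightarrow> bool" where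
  "bounded_smooth_domain \<Omega> \<longleftrightarrow> open \<Omega> \<and> connected \<Omega> \<and> \<Omega> \<noteq> {} \<and> bounded \<Omega> \<and>
     (\<forall>x0\<in>frontier \<Omega>. \<exists>U \<rho>. open U \<and> x0 \<in> U \<and> smooth_fun \<rho> \<and>
        (\<forall>x\<in>U. frechet_derivative \<rho> (at x) \<noteq> (\<lambda>_. 0)) \<and>
        \<Omega> \<inter> U = {x\<in>U. \<rho> x < 0})"

definition test_fun :: "('a::euclidean_space) set \<Rightarrow> ('a \<Rightarrow> real) \<Rightarrow> bool" where
  "test_fun \<Omega> \<phi> \<longleftrightarrow> smooth_fun \<phi> \<and> compact (closure {x. \<phi> x \<noteq> 0}) \<and>
      closure {x. \<phi> x \<noteq> 0} \<subseteq> \<Omega>"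

definition frac_sobolev :: "real \<Rightarrow> real \<Rightarrow> ('a::euclidean_space \<Rightarrow> real) \<Rightarrow> bool" where
  "frac_sobolev s p U \<longleftrightarrow> U \<in> borel_measurable lborel \<and>
     (\<integral>\<^sup>+ x. ennreal (\<bar>U x\<bar> powr p) \<partial>lborel) < \<infinity> \<and>
     (\<integral>\<^sup>+ z. ennreal (\<bar>U (fst z) - U (snd z)\<bar> powr p /
          norm (fst z - snd z) powr (real DIM('a) + s * p)) \<partial>(lborel \<Otimes>\<^sub>M lborel)) < \<infinity>"

definition frac_sobolev0 :: "real \<Rightarrow> real \<Rightarrow> 'a set \<Rightarrow> ('a::euclidean_space \<Rightarrow> real) \<Rightarrow> bool" where
  "frac_sobolev0 s p \<Omega> U \<longleftrightarrow> frac_sobolev s p U \<and> (AE x in lborel. x \<notin> \<Omega> \<longrightarrow> U x = 0)"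

definition frac_plap_pair :: "real \<Rightarrow> real \<Rightarrow> ('a::euclidean_space \<Rightarrow> real) \<Rightarrow> ('a \<Rightarrow> real) \<Rightarrow> real" where
  "frac_plap_pair s p U \<phi> = (\<integral> z. spow (p - 1) (U (fst z) - U (snd z)) * (\<phi> (fst z) - \<phi> (snd z)) /
       norm (fst z - snd z) powr (real DIM('a) + s * p) \<partial>(lborel \<Otimes>\<^sub>M lborel))"

text \<open>Graph of A: opA s p m Omega u f means u \<in> D(A) (u in L^1(Omega), [u]^m in W^{s,p}_0)
  and f \<in> L^1(Omega) represents (-Delta)^s_p [u]^m weakly (against test functions), i.e. Au = f.\<close>
definition opA :: "real \<Rightarrow> real \<Rightarrow> real \<Rightarrow> 'a set \<Rightarrow> ('a::euclidean_space \<Rightarrow> real) \<Rightarrow> ('a \<Rightarrow> real) \<Rightarrow> bool" where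
  "opA s p m \<Omega> u f \<longleftrightarrow> u \<in> borel_measurable lborel \<and> set_integrable lborel \<Omega> u \<and>
     frac_sobolev0 s p \<Omega> (\<lambda>x. spow m (u x)) \<and>
     f \<in> borel_measurable lborel \<and> set_integrable lborel \<Omega> f \<and>
     (\<forall>\<phi>. test_fun \<Omega> \<phi> \<longrightarrow> frac_plap_pair s p (\<lambda>x. spow m (u x)) \<phi> = (LINT x:\<Omega>|lborel. f x * \<phi> x))"

end

theory Submission
  imports Defs "HOL-Real_Asymp.Real_Asymp"
begin

text \<open>Put \<open>U = [u]\<^sup>m\<close>, \<open>V = [v]\<^sup>m\<close>. Testing the difference of the two equations with \<open>T\<^sub>n(U - V)\<close>, where
  \<open>T\<^sub>n(t)\<close> is \<open>n t\<close> clamped to \<open>[-1, 1]\<close>, gives \<open>\<integral> (f - g) T\<^sub>n(U - V) \<ge> 0\<close>, since \<open>[\<cdot>]\<close> and \<open>T\<^sub>n\<close> are monotone;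
  as \<open>n\<close> grows, \<open>T\<^sub>n(U - V)\<close> tends to \<open>sgn (u - v)\<close>, which is the required \<open>w\<close>.

  The equations only hold against smooth functions with compact support in \<open>\<Omega>\<close>, so the test function is first
  cut off near the boundary and then mollified. The cutoff converges in energy by dominated convergence: a smooth
  bounded domain has exterior balls of size comparable to the distance \<open>d(x)\<close> to the complement, so for a
  function \<open>W\<close> vanishing off \<open>\<Omega>\<close> the part \<open>x \<in> \<Omega>\<close>, \<open>y \<notin> \<Omega>\<close> of the seminorm already dominates the integral
  of \<open>|W|\<^sup>p d\<^bsup>-sp\<^esup>\<close>, for every \<open>s\<close> and \<open>p\<close>. The mollification converges weakly, because
  \<open>h \<mapsto> \<integral> F(z) G(z - h) dz\<close> is continuous for \<open>F\<close> and \<open>G\<close> in dual Lebesgue spaces.\<close>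

section \<open>Continuity of translations\<close>

text \<open>The sources \<open>f\<close> and \<open>g\<close> are merely integrable, so they can be
  paired only with bounded test functions; this forces the clamp, and its Lipschitz bound keeps the
  clamped difference at finite energy. No density of smooth functions in a Sobolev norm is required:
  only the pairing with one fixed dual element has to converge, and there Young's inequality with a
  free parameter does the work of Hoelder's. Mollification respects the energy because the kernel
  depends on \<open>x - y\<close> alone: averaging \<open>W\<close> over shifts \<open>h\<close>
  averages its difference quotient over the diagonal shifts \<open>(h, h)\<close>. The exterior
  estimate is available because \<open>frac_sobolev\<close> integrates over the square of the whole
  space, so the seminorm contains the interaction of \<Omega> with its complement; a Hardy
  inequality confined to \<Omega>, with its exceptional exponents, is avoided. The map
  \<open>spow m\<close> is strictly increasing, so \<open>U - V\<close> and \<open>u - v\<close>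
  have the same sign. With \<open>w\<close> this sign, \<open>|u - v| = (u - v) w\<close> and
  \<open>|w| \<le> 1\<close>, and the norm inequality results from adding \<open>t\<close> times the
  sign test.\<close>

lemma distr_lborel_minus: "distr lborel borel (\<lambda>x. x - h) = (lborel :: 'a::euclidean_space measure)"
proof -
  have "(\<lambda>x::'a. x - h) = (+) (- h)" by (auto simp: fun_eq_iff)
  then show ?thesis by (simp add: lborel_distr_plus)
qed

lemma integral_lborel_translate:
  fixes f :: "'a::euclidean_space \<Rightarrow> real"
  assumes [measurable]: "f \<in> borel_measurable borel"
  shows "(LINT x|lborel. f (x - h)) = (LINT x|lborel. f x)"
proof -
  have "(LINT x|lborel. f x) = (LINT x|distr lborel borel (\<lambda>x. x - h). f x)"
    by (simp add: distr_lborel_minus)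
  also have "\<dots> = (LINT x|lborel. f (x - h))"
    by (subst integral_distr) auto
  finally show ?thesis by simp
qed

lemma integrable_lborel_translate:
  fixes f :: "'a::euclidean_space \<Rightarrow> real"
  assumes "integrable lborel f"
  shows "integrable lborel (\<lambda>x. f (x - h))"
proof -
  have "integrable (distr lborel borel (\<lambda>x. x - h)) f" using assms by (simp add: distr_lborel_minus)
  then show ?thesis by (subst (asm) integrable_distr_eq) (use assms in auto)
qed

text \<open>The factor 2 arises because the error \<open>f - g\<close> enters once at
  \<open>x - h\<close> and once at \<open>x\<close>, with equal integrals by translation
  invariance.\<close>

lemma translate_L1_triangle:
  fixes f g :: "'a::euclidean_space \<Rightarrow> real"
  assumes f: "integrable lborel f" and g: "integrable lborel g"
  shows "(LINT x|lborel. \<bar>f (x - h) - f x\<bar>)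
      \<le> (LINT x|lborel. \<bar>g (x - h) - g x\<bar>) + 2 * (LINT x|lborel. \<bar>f x - g x\<bar>)"
proof -
  have [measurable]: "f \<in> borel_measurable borel" "g \<in> borel_measurable borel"
    using f g by auto
  note fh = integrable_lborel_translate[OF f, of h] and gh = integrable_lborel_translate[OF g, of h]
  have "(LINT x|lborel. \<bar>f (x - h) - f x\<bar>)
      \<le> (LINT x|lborel. \<bar>g (x - h) - g x\<bar> + \<bar>f (x - h) - g (x - h)\<bar> + \<bar>f x - g x\<bar>)"
    by (intro integral_mono integrable_abs Bochner_Integration.integrable_add
        Bochner_Integration.integrable_diff f g fh gh) auto
  also have "\<dots> = (LINT x|lborel. \<bar>g (x - h) - g x\<bar>) + (LINT x|lborel. \<bar>f (x - h) - g (x - h)\<bar>)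
      + (LINT x|lborel. \<bar>f x - g x\<bar>)"
    by (subst Bochner_Integration.integral_add | intro integrable_abs Bochner_Integration.integrable_add
        Bochner_Integration.integrable_diff f g fh gh refl)+
  also have "(LINT x|lborel. \<bar>f (x - h) - g (x - h)\<bar>) = (LINT x|lborel. \<bar>f x - g x\<bar>)"
    by (rule integral_lborel_translate) simp
  finally show ?thesis by simp
qed

text \<open>The functions whose translates converge form an \<open>L\<^sup>1\<close>-closed set.
  This closedness serves twice: to pass from open to measurable sets, and in the limit case of the
  induction on integrable functions.\<close>

lemma translate_L1_tendsto_0_by_approx:
  fixes f :: "'a::euclidean_space \<Rightarrow> real"
  assumes f: "integrable lborel f"
    and ap: "\<And>e. e > 0 \<Longrightarrow> \<exists>g. integrable lborel g \<and> (LINT x|lborel. \<bar>f x - g x\<bar>) < e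
               \<and> (\<lambda>n. LINT x|lborel. \<bar>g (x - h n) - g x\<bar>) \<longlonglongrightarrow> 0"
  shows "(\<lambda>n. LINT x|lborel. \<bar>f (x - h n) - f x\<bar>) \<longlonglongrightarrow> 0"
proof (rule LIMSEQ_I)
  fix e :: real assume e: "e > 0"
  obtain g where g: "integrable lborel g" "(LINT x|lborel. \<bar>f x - g x\<bar>) < e / 4"
    and lim: "(\<lambda>n. LINT x|lborel. \<bar>g (x - h n) - g x\<bar>) \<longlonglongrightarrow> 0"
    using ap[of "e/4"] e by auto
  obtain N where N: "\<And>n. n \<ge> N \<Longrightarrow> norm ((LINT x|lborel. \<bar>g (x - h n) - g x\<bar>) - 0) < e / 2"
    using LIMSEQ_D[OF lim, of "e/2"] e by auto
  have "norm ((LINT x|lborel. \<bar>f (x - h n) - f x\<bar>) - 0) < e" if "n \<ge> N" for n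
  proof -
    have "(LINT x|lborel. \<bar>f (x - h n) - f x\<bar>) \<ge> 0" by simp
    moreover have "(LINT x|lborel. \<bar>g (x - h n) - g x\<bar>) < e / 2" using N[OF that] by simp
    ultimately show ?thesis using translate_L1_triangle[OF f g(1), of "h n"] g(2) by simp
  qed
  then show "\<exists>N. \<forall>n\<ge>N. norm ((LINT x|lborel. \<bar>f (x - h n) - f x\<bar>) - 0) < e" by blast
qed

text \<open>For indicators, \<open>|a - b| = a + b - 2 a b\<close>, so everything reduces to the
  overlap of \<open>S\<close> with its translate. Openness gives pointwise convergence of the
  overlap: a point of \<open>S\<close> stays in \<open>S\<close> under small shifts, and points off
  \<open>S\<close> contribute nothing.\<close>

lemma translate_L1_tendsto_0_open:
  fixes S :: "'a::euclidean_space set"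
  assumes S: "open S" "emeasure lborel S < \<infinity>" and h: "h \<longlonglongrightarrow> 0"
  shows "(\<lambda>n. LINT x|lborel. \<bar>indicator S (x - h n) - indicator S x :: real\<bar>) \<longlonglongrightarrow> 0"
proof -
  have [measurable]: "S \<in> sets borel" using S by auto
  let ?i = "indicator S :: 'a \<Rightarrow> real"
  have int: "integrable lborel ?i" using S by (simp add: integrable_indicator_iff)
  have int2: "integrable lborel (\<lambda>x. ?i x * ?i (x - k))" for k
    by (rule Bochner_Integration.integrable_bound[OF int]) (auto simp: indicator_def)
  have eq: "(LINT x|lborel. \<bar>?i (x - k) - ?i x\<bar>)
      = 2 * ((LINT x|lborel. ?i x) - (LINT x|lborel. ?i x * ?i (x - k)))" for k
  proof -
    have "(LINT x|lborel. \<bar>?i (x - k) - ?i x\<bar>)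
        = (LINT x|lborel. ?i (x - k) + ?i x - 2 * (?i x * ?i (x - k)))"
      by (intro Bochner_Integration.integral_cong) (auto simp: indicator_def)
    also have "\<dots> = (LINT x|lborel. ?i (x - k)) + (LINT x|lborel. ?i x) - 2 * (LINT x|lborel. ?i x * ?i (x - k))"
      using integrable_lborel_translate[OF int, of k] int int2[of k] by simp
    finally show ?thesis using integral_lborel_translate[of ?i k] by simp
  qed
  have "(\<lambda>n. LINT x|lborel. ?i x * ?i (x - h n)) \<longlonglongrightarrow> (LINT x|lborel. ?i x)"
  proof (rule integral_dominated_convergence[where w = ?i])
    show "AE x in lborel. (\<lambda>n. ?i x * ?i (x - h n)) \<longlonglongrightarrow> ?i x"
    proof (rule AE_I2)
      fix x :: 'a
      show "(\<lambda>n. ?i x * ?i (x - h n)) \<longlonglongrightarrow> ?i x"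
      proof (cases "x \<in> S")
        case True
        have "(\<lambda>n. x - h n) \<longlonglongrightarrow> x" using tendsto_diff[OF tendsto_const h] by simp
        then have "\<forall>\<^sub>F n in sequentially. x - h n \<in> S" using S True topological_tendstoD by blast
        then have "\<forall>\<^sub>F n in sequentially. ?i x * ?i (x - h n) = ?i x"
          by eventually_elim (use True in auto)
        then show ?thesis by (rule tendsto_eventually)
      qed auto
    qed
  qed (use int in \<open>auto simp: indicator_def\<close>)
  then have "(\<lambda>n. 2 * ((LINT x|lborel. ?i x) - (LINT x|lborel. ?i x * ?i (x - h n)))) \<longlonglongrightarrow>
     2 * ((LINT x|lborel. ?i x) - (LINT x|lborel. ?i x))"
    by (intro tendsto_intros)
  then show ?thesis by (simp add: eq)
qed

text \<open>Outer regularity approximates a measurable set of finite measure by open sets; linearity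
  and \<open>L\<^sup>1\<close>-closedness then reach every integrable function.\<close>

lemma translate_L1_tendsto_0:
  fixes f :: "'a::euclidean_space \<Rightarrow> real"
  assumes f: "integrable lborel f" and h: "h \<longlonglongrightarrow> 0"
  shows "(\<lambda>n. LINT x|lborel. \<bar>f (x - h n) - f x\<bar>) \<longlonglongrightarrow> 0"
  using f
proof (induction rule: integrable_induct)
  case (base A c)
  then have [measurable]: "A \<in> sets borel" by simp
  have iA: "integrable lborel (indicator A :: 'a \<Rightarrow> real)"
    using base by (simp add: integrable_indicator_iff)
  have "(\<lambda>n. LINT x|lborel. \<bar>indicator A (x - h n) - indicator A x :: real\<bar>) \<longlonglongrightarrow> 0"
  proof (rule translate_L1_tendsto_0_by_approx[OF iA])
    fix e :: real assume e: "e > 0"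
    obtain S where S: "open S" "A \<subseteq> S" "emeasure lborel (S - A) < e"
      using outer_regular_lborel[of A e] e by auto
    have [measurable]: "S \<in> sets borel" using S by auto
    have "emeasure lborel S = emeasure lborel A + emeasure lborel (S - A)"
      using S(2) by (subst plus_emeasure) (auto simp: Un_absorb1)
    also have "\<dots> < \<infinity>"
      using base(2) S(3) by (simp add: ennreal_add_less_top order.strict_trans[OF S(3)])
    finally have fin: "emeasure lborel S < \<infinity>" .
    have iS: "integrable lborel (indicator S :: 'a \<Rightarrow> real)"
      using fin by (simp add: integrable_indicator_iff)
    have "(LINT x|lborel. \<bar>indicator A x - indicator S x :: real\<bar>) = (LINT x|lborel. indicator (S - A) x)"
      using S(2) by (intro Bochner_Integration.integral_cong) (auto simp: indicator_def)
    also have "\<dots> = measure lborel (S - A)" by simp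
    also have "\<dots> < e" using S(3) e unfolding measure_def
      by (metis ennreal_less_iff enn2real_less_iff enn2real_positive_iff enn2real_nonneg ennreal_enn2real_if less_top order.strict_trans ennreal_less_top)
    finally have "(LINT x|lborel. \<bar>indicator A x - indicator S x :: real\<bar>) < e" .
    then show "\<exists>g. integrable lborel g \<and> (LINT x|lborel. \<bar>indicator A x - g x\<bar>) < e
               \<and> (\<lambda>n. LINT x|lborel. \<bar>g (x - h n) - g x\<bar>) \<longlonglongrightarrow> 0"
      using iS translate_L1_tendsto_0_open[OF S(1) fin h] by blast
  qed
  then have "(\<lambda>n. \<bar>c\<bar> * (LINT x|lborel. \<bar>indicator A (x - h n) - indicator A x :: real\<bar>)) \<longlonglongrightarrow> \<bar>c\<bar> * 0"
    by (intro tendsto_intros)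
  also have "(\<lambda>n. \<bar>c\<bar> * (LINT x|lborel. \<bar>indicator A (x - h n) - indicator A x :: real\<bar>))
      = (\<lambda>n. LINT x|lborel. \<bar>indicator A (x - h n) *\<^sub>R c - indicator A x *\<^sub>R c\<bar>)"
  proof
    fix n
    have "\<bar>indicator A (x - h n) *\<^sub>R c - indicator A x *\<^sub>R c\<bar> = \<bar>c\<bar> * \<bar>indicator A (x - h n) - indicator A x\<bar>" for x
      by (metis abs_mult mult.commute real_scaleR_def scaleR_left_diff_distrib)
    then show "\<bar>c\<bar> * (LINT x|lborel. \<bar>indicator A (x - h n) - indicator A x :: real\<bar>)
        = (LINT x|lborel. \<bar>indicator A (x - h n) *\<^sub>R c - indicator A x *\<^sub>R c\<bar>)"
      by simp
  qed
  finally show ?case by simp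
next
  case (add f g)
  note [measurable] = borel_measurable_integrable[OF add(1)] borel_measurable_integrable[OF add(2)]
  show ?case
  proof (rule tendsto_sandwich[OF _ _ tendsto_const])
    show "(\<lambda>n. (LINT x|lborel. \<bar>f (x - h n) - f x\<bar>) + (LINT x|lborel. \<bar>g (x - h n) - g x\<bar>)) \<longlonglongrightarrow> 0"
      using tendsto_add[OF add(3,4)] by simp
    show "\<forall>\<^sub>F n in sequentially. (LINT x|lborel. \<bar>f (x - h n) + g (x - h n) - (f x + g x)\<bar>)
       \<le> (LINT x|lborel. \<bar>f (x - h n) - f x\<bar>) + (LINT x|lborel. \<bar>g (x - h n) - g x\<bar>)"
    proof (rule always_eventually, rule allI)
      fix n
      note ii = add(1,2) integrable_lborel_translate[OF add(1), of "h n"] integrable_lborel_translate[OF add(2), of "h n"]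
      have "(LINT x|lborel. \<bar>f (x - h n) + g (x - h n) - (f x + g x)\<bar>)
        \<le> (LINT x|lborel. \<bar>f (x - h n) - f x\<bar> + \<bar>g (x - h n) - g x\<bar>)"
        using ii by (intro integral_mono integrable_abs Bochner_Integration.integrable_add
           Bochner_Integration.integrable_diff) auto
      also have "\<dots> = (LINT x|lborel. \<bar>f (x - h n) - f x\<bar>) + (LINT x|lborel. \<bar>g (x - h n) - g x\<bar>)"
        using ii by (intro Bochner_Integration.integral_add) auto
      finally show "(LINT x|lborel. \<bar>f (x - h n) + g (x - h n) - (f x + g x)\<bar>)
       \<le> (LINT x|lborel. \<bar>f (x - h n) - f x\<bar>) + (LINT x|lborel. \<bar>g (x - h n) - g x\<bar>)" .
    qed
  qed auto
next
  case (lim f s)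
  show ?case
  proof (rule translate_L1_tendsto_0_by_approx[OF lim(4)])
    fix e :: real assume e: "e > 0"
    note [measurable] = borel_measurable_integrable[OF lim(1)] borel_measurable_integrable[OF lim(4)]
    have "(\<lambda>i. LINT x|lborel. \<bar>f x - s i x\<bar>) \<longlonglongrightarrow> (LINT x::'a|lborel. 0)"
    \<comment> \<open>The induction supplies approximants with \<open>|s i x| \<le> 2 |f x|\<close>,
      hence the factor 3 for the difference.\<close>
    proof (rule integral_dominated_convergence[where w = "\<lambda>x. 3 * \<bar>f x\<bar>"])
      show "AE x in lborel. (\<lambda>i. \<bar>f x - s i x\<bar>) \<longlonglongrightarrow> 0"
      proof (rule AE_I2)
        fix x show "(\<lambda>i. \<bar>f x - s i x\<bar>) \<longlonglongrightarrow> 0"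
          using tendsto_rabs[OF tendsto_diff[OF tendsto_const lim(2)[of x]], of "f x"] by simp
      qed
      show "AE x in lborel. norm \<bar>f x - s i x\<bar> \<le> 3 * \<bar>f x\<bar>" for i
      proof (rule AE_I2)
        fix x show "norm \<bar>f x - s i x\<bar> \<le> 3 * \<bar>f x\<bar>" using lim(3)[of x i] by simp
      qed
    qed (use lim(4) in auto)
    then have "(\<lambda>i. LINT x|lborel. \<bar>f x - s i x\<bar>) \<longlonglongrightarrow> 0" by simp
    then obtain i where "norm ((LINT x|lborel. \<bar>f x - s i x\<bar>) - 0) < e"
      using LIMSEQ_D[of _ 0 e] e by blast
    then show "\<exists>g. integrable lborel g \<and> (LINT x|lborel. \<bar>f x - g x\<bar>) < e
               \<and> (\<lambda>n. LINT x|lborel. \<bar>g (x - h n) - g x\<bar>) \<longlonglongrightarrow> 0"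
      using lim(1,5) by auto
  qed
qed

section \<open>Young's inequality and translations in pairings of dual Lebesgue spaces\<close>

text \<open>One of the two powers alone dominates the product: \<open>y powr p\<close> if
  \<open>x \<le> y powr (p - 1)\<close>, and the power of \<open>x\<close> otherwise. Sharp
  constants would gain nothing in what follows.\<close>

lemma young_powr:
  fixes x y p :: real
  assumes "x \<ge> 0" "y \<ge> 0" "1 < p"
  shows "x * y \<le> x powr (p / (p - 1)) + y powr p"
proof (cases "x = 0 \<or> y = 0")
  case False
  then have xy: "x > 0" "y > 0" using assms by auto
  show ?thesis
  proof (cases "x \<le> y powr (p - 1)")
    case True
    then have "x * y \<le> y powr (p - 1) * y" using xy by simp
    also have "\<dots> = y powr p" using xy by (simp add: powr_mult_base mult.commute)
    finally show ?thesis using powr_ge_zero[of x "p / (p - 1)"] by linarith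
  next
    case False
    then have "(y powr (p - 1)) powr (1 / (p - 1)) \<le> x powr (1 / (p - 1))"
      using assms by (intro powr_mono2) auto
    then have "y \<le> x powr (1 / (p - 1))" using xy assms by (simp add: powr_powr)
    then have "x * y \<le> x * x powr (1 / (p - 1))" using xy by simp
    also have "\<dots> = x powr (1 + 1 / (p - 1))" using xy by (simp add: powr_mult_base)
    also have "1 + 1 / (p - 1) = p / (p - 1)" using assms by (simp add: field_simps)
    finally show ?thesis using powr_ge_zero[of y p] by linarith
  qed
qed auto

text \<open>Applied to \<open>K x\<close> and \<open>y / K\<close>: a large \<open>K\<close> makes
  the weight of \<open>y\<close> small at the price of a large weight on \<open>x\<close>.\<close>

lemma young_powr_eps:
  fixes x y p K :: real
  assumes "K > 0" "1 < p"
  shows "\<bar>x * y\<bar> \<le> K powr (p / (p - 1)) * \<bar>x\<bar> powr (p / (p - 1)) + (1 / K) powr p * \<bar>y\<bar> powr p"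
proof -
  have "\<bar>x * y\<bar> = (K * \<bar>x\<bar>) * (1 / K * \<bar>y\<bar>)" using assms by (simp add: abs_mult)
  also have "\<dots> \<le> (K * \<bar>x\<bar>) powr (p / (p - 1)) + (1 / K * \<bar>y\<bar>) powr p"
    using assms by (intro young_powr) auto
  also have "\<dots> = K powr (p / (p - 1)) * \<bar>x\<bar> powr (p / (p - 1)) + (1 / K) powr p * \<bar>y\<bar> powr p"
    using assms by (simp only: powr_mult)
  finally show ?thesis .
qed

text \<open>Cutting off small values as well as large ones makes an \<open>L\<^sup>q\<close> function both bounded and integrable.\<close>
definition trunc_band :: "real \<Rightarrow> real \<Rightarrow> real" where
  "trunc_band M t = (if 1 / M \<le> \<bar>t\<bar> \<and> \<bar>t\<bar> \<le> M then t else 0)"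

lemma measurable_trunc_band [measurable]: "trunc_band M \<in> borel_measurable borel"
  unfolding trunc_band_def by measurable

lemma trunc_band_le: "\<bar>trunc_band M t\<bar> \<le> \<bar>t\<bar>" "\<bar>t - trunc_band M t\<bar> \<le> \<bar>t\<bar>"
  "M > 0 \<Longrightarrow> \<bar>trunc_band M t\<bar> \<le> M"
  by (auto simp: trunc_band_def)

text \<open>Where the truncation is nonzero, \<open>1 \<le> M |t|\<close>, so
  \<open>|t| \<le> M \<le> M (M |t|) powr q\<close>; this is the origin of the constant
  \<open>M * M powr q\<close>.\<close>

lemma trunc_band_integrable:
  fixes F :: "'a \<Rightarrow> real"
  assumes M: "M > 0" and q: "q > 0" and [measurable]: "F \<in> borel_measurable N"
    and F: "integrable N (\<lambda>x. \<bar>F x\<bar> powr q)"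
  shows "integrable N (\<lambda>x. trunc_band M (F x))"
proof (rule Bochner_Integration.integrable_bound)
  show "integrable N (\<lambda>x. (M * M powr q) * \<bar>F x\<bar> powr q)" using F by simp
  have "\<bar>trunc_band M t\<bar> \<le> M * M powr q * \<bar>t\<bar> powr q" for t
  proof (cases "1 / M \<le> \<bar>t\<bar> \<and> \<bar>t\<bar> \<le> M")
    case True
    then have "1 \<le> M * \<bar>t\<bar>" using M by (simp add: field_simps)
    then have "1 \<le> (M * \<bar>t\<bar>) powr q" using q by (simp add: ge_one_powr_ge_zero)
    then have "M * 1 \<le> M * (M powr q * \<bar>t\<bar> powr q)" using M by (intro mult_left_mono) (auto simp: powr_mult)
    then show ?thesis using True by (simp add: trunc_band_def)
  next
    case False
    then have "trunc_band M t = 0" by (auto simp: trunc_band_def)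
    then show ?thesis using M by simp
  qed
  then show "AE x in N. norm (trunc_band M (F x)) \<le> norm (M * M powr q * \<bar>F x\<bar> powr q)"
    using M by (intro AE_I2) simp
qed simp

lemma trunc_band_remainder_tendsto:
  fixes F :: "'a \<Rightarrow> real"
  assumes q: "q > 0" and [measurable]: "F \<in> borel_measurable N"
    and F: "integrable N (\<lambda>x. \<bar>F x\<bar> powr q)"
  shows "(\<lambda>n. LINT x|N. \<bar>F x - trunc_band (real (Suc n)) (F x)\<bar> powr q) \<longlonglongrightarrow> 0"
proof -
  have "(\<lambda>n. LINT x|N. \<bar>F x - trunc_band (real (Suc n)) (F x)\<bar> powr q) \<longlonglongrightarrow> (LINT x|N. 0)"
  proof (rule integral_dominated_convergence[where w = "\<lambda>x. \<bar>F x\<bar> powr q"])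
    show "AE x in N. (\<lambda>n. \<bar>F x - trunc_band (real (Suc n)) (F x)\<bar> powr q) \<longlonglongrightarrow> 0"
    proof (rule AE_I2)
      fix x
      show "(\<lambda>n. \<bar>F x - trunc_band (real (Suc n)) (F x)\<bar> powr q) \<longlonglongrightarrow> 0"
      proof (cases "F x = 0")
        case True then show ?thesis by (simp add: trunc_band_def)
      next
        case False
        obtain k where k: "real k > max \<bar>F x\<bar> (1 / \<bar>F x\<bar>)" using reals_Archimedean2 by blast
        have "\<bar>F x - trunc_band (real (Suc n)) (F x)\<bar> powr q = 0" if "n \<ge> k" for n
        proof -
          have "real (Suc n) \<ge> real k" using that by simp
          then have n: "\<bar>F x\<bar> \<le> real (Suc n)" "1 / \<bar>F x\<bar> \<le> real (Suc n)" using k by linarith+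
          then have "1 / real (Suc n) \<le> \<bar>F x\<bar>" using False by (simp add: field_simps)
          then show ?thesis using n by (simp add: trunc_band_def)
        qed
        then have "\<forall>\<^sub>F n in sequentially. \<bar>F x - trunc_band (real (Suc n)) (F x)\<bar> powr q = 0"
          unfolding eventually_sequentially by blast
        then show ?thesis by (rule tendsto_eventually)
      qed
    qed
    show "AE x in N. norm (\<bar>F x - trunc_band (real (Suc n)) (F x)\<bar> powr q) \<le> \<bar>F x\<bar> powr q" for n
      using q by (intro AE_I2) (auto intro!: powr_mono2 trunc_band_le)
  qed (use F in auto)
  then show ?thesis by simp
qed

lemma integrable_mult_conjugate:
  fixes F G :: "'a \<Rightarrow> real"
  assumes p: "1 < p" and [measurable]: "F \<in> borel_measurable N" "G \<in> borel_measurable N"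
    and F: "integrable N (\<lambda>x. \<bar>F x\<bar> powr (p / (p - 1)))" and G: "integrable N (\<lambda>x. \<bar>G x\<bar> powr p)"
  shows "integrable N (\<lambda>x. F x * G x)"
proof (rule Bochner_Integration.integrable_bound)
  show "integrable N (\<lambda>x. \<bar>F x\<bar> powr (p / (p - 1)) + \<bar>G x\<bar> powr p)" using F G by simp
  show "AE x in N. norm (F x * G x) \<le> norm (\<bar>F x\<bar> powr (p / (p - 1)) + \<bar>G x\<bar> powr p)"
    using young_powr_eps[of 1 p] p by (intro AE_I2) auto
qed simp

lemma integral_mult_conjugate_le:
  fixes F G :: "'a \<Rightarrow> real"
  assumes p: "1 < p" and K: "K > 0" and [measurable]: "F \<in> borel_measurable N" "G \<in> borel_measurable N"
    and F: "integrable N (\<lambda>x. \<bar>F x\<bar> powr (p / (p - 1)))" and G: "integrable N (\<lambda>x. \<bar>G x\<bar> powr p)"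
  shows "\<bar>LINT x|N. F x * G x\<bar> \<le> K powr (p / (p - 1)) * (LINT x|N. \<bar>F x\<bar> powr (p / (p - 1)))
           + (1 / K) powr p * (LINT x|N. \<bar>G x\<bar> powr p)"
proof -
  have "\<bar>LINT x|N. F x * G x\<bar> \<le> (LINT x|N. \<bar>F x * G x\<bar>)" by (rule integral_abs_bound)
  also have "\<dots> \<le> (LINT x|N. K powr (p / (p - 1)) * \<bar>F x\<bar> powr (p / (p - 1)) + (1 / K) powr p * \<bar>G x\<bar> powr p)"
    using young_powr_eps[OF K p] F G integrable_mult_conjugate[OF p _ _ F G]
    by (intro integral_mono) auto
  also have "\<dots> = K powr (p / (p - 1)) * (LINT x|N. \<bar>F x\<bar> powr (p / (p - 1)))
           + (1 / K) powr p * (LINT x|N. \<bar>G x\<bar> powr p)"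
    using F G by simp
  finally show ?thesis .
qed

text \<open>The order of choice matters: \<open>K\<close> is fixed by the factor that is only
  bounded, and \<open>\<delta>\<close> is then adapted to the resulting large weight on the factor
  that can be made small.\<close>

lemma exists_eps_split:
  fixes A B p e :: real
  assumes "1 < p" "A \<ge> 0" "B \<ge> 0" "e > 0"
  obtains K \<delta> where "K > 0" "\<delta> > 0"
    "\<And>a b. 0 \<le> a \<Longrightarrow> 0 \<le> b \<Longrightarrow> a \<le> \<delta> \<Longrightarrow> b \<le> B \<Longrightarrow> K powr (p / (p - 1)) * a + (1 / K) powr p * b \<le> e"
proof -
  have "((\<lambda>K. (1 / K) powr p * B) \<longlongrightarrow> 0) at_top"
    using assms by real_asymp
  then have "\<forall>\<^sub>F K in at_top. (1 / K) powr p * B < e / 2" using assms by (intro order_tendstoD) auto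
  then obtain K where K: "K > 0" "(1 / K) powr p * B < e / 2"
    by (metis (mono_tags, lifting) eventually_at_top_linorder gt_ex le_less order_less_le_trans linorder_not_le)
  let ?d = "e / (2 * K powr (p / (p - 1)))"
  show thesis
  proof (rule that[of K ?d])
    fix a b :: real assume ab: "0 \<le> a" "0 \<le> b" "a \<le> ?d" "b \<le> B"
    have "K powr (p / (p - 1)) * a \<le> K powr (p / (p - 1)) * ?d" using ab by (intro mult_left_mono) auto
    moreover have "K powr (p / (p - 1)) * ?d = e / 2" using K by simp
    moreover have "(1 / K) powr p * b \<le> (1 / K) powr p * B" using ab by (intro mult_left_mono) auto
    ultimately show "K powr (p / (p - 1)) * a + (1 / K) powr p * b \<le> e" using K by linarith
  qed (use K assms in auto)
qed

text \<open>Both functions are split into a truncated part and a remainder. Terms with a remainder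
  are small uniformly in the shift, since a shift preserves the \<open>L\<^sup>p\<close> norm; in
  the last term \<open>F1\<close> is bounded and \<open>G1\<close> integrable, so continuity of
  translations in \<open>L\<^sup>1\<close> applies.\<close>

lemma translate_pairing_tendsto:
  fixes F G :: "'a::euclidean_space \<Rightarrow> real"
  assumes p: "1 < p" and [measurable]: "F \<in> borel_measurable borel" "G \<in> borel_measurable borel"
    and F: "integrable lborel (\<lambda>x. \<bar>F x\<bar> powr (p / (p - 1)))"
    and G: "integrable lborel (\<lambda>x. \<bar>G x\<bar> powr p)"
    and h: "h \<longlonglongrightarrow> 0"
  shows "(\<lambda>n. LINT x|lborel. F x * G (x - h n)) \<longlonglongrightarrow> (LINT x|lborel. F x * G x)"
proof (rule LIMSEQ_I)
  fix e :: real assume e: "e > 0"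
  \<comment> \<open>The exponent conjugate to \<open>q\<close> is again \<open>p\<close>, so the
    same estimates apply with the roles of \<open>F\<close> and \<open>G\<close> exchanged.\<close>
  define q where "q = p / (p - 1)"
  have q: "1 < q" "q / (q - 1) = p" using p by (auto simp: q_def field_simps)
  define A where "A = (LINT x|lborel. \<bar>F x\<bar> powr q)"
  define B where "B = (LINT x|lborel. \<bar>G x\<bar> powr p)"
  note F = F[folded q_def]
  have AB: "A \<ge> 0" "B \<ge> 0" by (auto simp: A_def B_def)
  \<comment> \<open>Four remainder terms occur, two at the shift \<open>h n\<close> and two at shift
    0. Each costs \<open>e / 10\<close>, and the truncated part costs \<open>e / 5\<close>.\<close>
  have e5: "e / 5 / 2 > 0" using e by simp
  obtain K1 d1 where K1: "K1 > 0" and d1: "d1 > 0"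
    and s1: "\<And>a b. 0 \<le> a \<Longrightarrow> 0 \<le> b \<Longrightarrow> a \<le> d1 \<Longrightarrow> b \<le> B \<Longrightarrow> K1 powr q * a + (1 / K1) powr p * b \<le> e / 5 / 2"
    using exists_eps_split[OF p AB(1,2) e5, folded q_def] by metis
  obtain K2 d2 where K2: "K2 > 0" and d2: "d2 > 0"
    and s2: "\<And>a b. 0 \<le> a \<Longrightarrow> 0 \<le> b \<Longrightarrow> a \<le> d2 \<Longrightarrow> b \<le> A \<Longrightarrow> K2 powr p * a + (1 / K2) powr q * b \<le> e / 5 / 2"
    using exists_eps_split[OF q(1) AB(2,1) e5, unfolded q(2)] by metis
  have "\<forall>\<^sub>F n in sequentially. (LINT x|lborel. \<bar>F x - trunc_band (real (Suc n)) (F x)\<bar> powr q) < d1"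
    using trunc_band_remainder_tendsto[OF _ _ F] q d1 by (intro order_tendstoD) auto
  moreover have "\<forall>\<^sub>F n in sequentially. (LINT x|lborel. \<bar>G x - trunc_band (real (Suc n)) (G x)\<bar> powr p) < d2"
    using trunc_band_remainder_tendsto[OF _ _ G] p d2 by (intro order_tendstoD) auto
  ultimately have "\<forall>\<^sub>F n in sequentially. (LINT x|lborel. \<bar>F x - trunc_band (real (Suc n)) (F x)\<bar> powr q) < d1
      \<and> (LINT x|lborel. \<bar>G x - trunc_band (real (Suc n)) (G x)\<bar> powr p) < d2"
    by (rule eventually_conj)
  then obtain n0 where n0: "(LINT x|lborel. \<bar>F x - trunc_band (real (Suc n0)) (F x)\<bar> powr q) < d1"
      "(LINT x|lborel. \<bar>G x - trunc_band (real (Suc n0)) (G x)\<bar> powr p) < d2"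
    by (auto simp: eventually_sequentially)
  define M where "M = real (Suc n0)"
  have M: "M > 0" by (simp add: M_def)
  define F1 where "F1 x = trunc_band M (F x)" for x
  define F2 where "F2 x = F x - trunc_band M (F x)" for x
  define G1 where "G1 x = trunc_band M (G x)" for x
  define G2 where "G2 x = G x - trunc_band M (G x)" for x
  have [measurable]: "F1 \<in> borel_measurable borel" "F2 \<in> borel_measurable borel"
    "G1 \<in> borel_measurable borel" "G2 \<in> borel_measurable borel"
    unfolding F1_def F2_def G1_def G2_def by measurable
  have iF: "integrable lborel (\<lambda>x. \<bar>F1 x\<bar> powr q)" "integrable lborel (\<lambda>x. \<bar>F2 x\<bar> powr q)"
    using q by (auto intro!: Bochner_Integration.integrable_bound[OF F] AE_I2 powr_mono2 trunc_band_le simp: F1_def F2_def)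
  have iG: "integrable lborel (\<lambda>x. \<bar>G1 x\<bar> powr p)" "integrable lborel (\<lambda>x. \<bar>G2 x\<bar> powr p)"
    using p by (auto intro!: Bochner_Integration.integrable_bound[OF G] AE_I2 powr_mono2 trunc_band_le simp: G1_def G2_def)
  have iG1: "integrable lborel G1"
    using trunc_band_integrable[OF M _ _ G] p unfolding G1_def by auto
  have A1: "(LINT x|lborel. \<bar>F1 x\<bar> powr q) \<le> A"
    unfolding A_def using q by (intro integral_mono iF F) (auto intro!: powr_mono2 trunc_band_le simp: F1_def)
  have tr: "integrable lborel (\<lambda>x. \<bar>g (x - k)\<bar> powr p)"
     "(LINT x|lborel. \<bar>g (x - k)\<bar> powr p) = (LINT x|lborel. \<bar>g x\<bar> powr p)"
    if "integrable lborel (\<lambda>x. \<bar>g x\<bar> powr p)" for g :: "'a \<Rightarrow> real" and k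
    using integrable_lborel_translate[OF that] integral_lborel_translate[OF borel_measurable_integrable[OF that, simplified]] by auto
  have T1: "\<bar>LINT x|lborel. F2 x * G (x - k)\<bar> \<le> e / 5 / 2" for k
  proof -
    have "\<bar>LINT x|lborel. F2 x * G (x - k)\<bar> \<le> K1 powr q * (LINT x|lborel. \<bar>F2 x\<bar> powr q) + (1 / K1) powr p * B"
      using integral_mult_conjugate_le[OF p K1, of F2 lborel "\<lambda>x. G (x - k)", folded q_def] iF tr[OF G, of k]
      by (simp add: B_def)
    also have "\<dots> \<le> e / 5 / 2" using n0(1) AB by (intro s1) (auto simp: F2_def M_def)
    finally show ?thesis .
  qed
  have T2: "\<bar>LINT x|lborel. F1 x * G2 (x - k)\<bar> \<le> e / 5 / 2" for k
  proof -
    have "\<bar>LINT x|lborel. G2 (x - k) * F1 x\<bar>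
        \<le> K2 powr p * (LINT x|lborel. \<bar>G2 x\<bar> powr p) + (1 / K2) powr q * (LINT x|lborel. \<bar>F1 x\<bar> powr q)"
      using integral_mult_conjugate_le[OF q(1) K2, of "\<lambda>x. G2 (x - k)" lborel F1, unfolded q(2)] iF tr[OF iG(2), of k]
      by simp
    also have "\<dots> \<le> e / 5 / 2" using n0(2) A1 by (intro s2) (auto simp: G2_def M_def)
    finally show ?thesis by (simp add: mult.commute)
  qed
  have lim: "(\<lambda>n. M * (LINT x|lborel. \<bar>G1 (x - h n) - G1 x\<bar>)) \<longlonglongrightarrow> M * 0"
    by (intro tendsto_intros translate_L1_tendsto_0 iG1 h)
  obtain N where N: "\<And>n. n \<ge> N \<Longrightarrow> M * (LINT x|lborel. \<bar>G1 (x - h n) - G1 x\<bar>) < e / 5"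
    using order_tendstoD(2)[OF lim, of "e/5"] e by (auto simp: eventually_sequentially)
  have "norm ((LINT x|lborel. F x * G (x - h n)) - (LINT x|lborel. F x * G x)) < e" if "n \<ge> N" for n
  proof -
    have i1: "integrable lborel (\<lambda>x. F2 x * G (x - k))" "integrable lborel (\<lambda>x. F1 x * G2 (x - k))"
      "integrable lborel (\<lambda>x. F1 x * G1 (x - k))" for k
      using integrable_mult_conjugate[OF p, of F2 lborel "\<lambda>x. G (x - k)"]
        integrable_mult_conjugate[OF p, of F1 lborel "\<lambda>x. G2 (x - k)"]
        integrable_mult_conjugate[OF p, of F1 lborel "\<lambda>x. G1 (x - k)"]
        iF tr[OF G] tr[OF iG(1)] tr[OF iG(2)] by (auto simp: q_def)
    have split: "(LINT x|lborel. F x * G (x - k)) = (LINT x|lborel. F2 x * G (x - k))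
       + (LINT x|lborel. F1 x * G2 (x - k)) + (LINT x|lborel. F1 x * G1 (x - k))" for k
    proof -
      have "(LINT x|lborel. F x * G (x - k)) = (LINT x|lborel. F2 x * G (x - k) + F1 x * G2 (x - k) + F1 x * G1 (x - k))"
        by (intro Bochner_Integration.integral_cong) (auto simp: F1_def F2_def G1_def G2_def algebra_simps)
      then show ?thesis using i1[of k] by simp
    qed
    have "\<bar>(LINT x|lborel. F1 x * G1 (x - h n)) - (LINT x|lborel. F1 x * G1 x)\<bar>
        = \<bar>LINT x|lborel. F1 x * (G1 (x - h n) - G1 x)\<bar>"
      using i1(3)[of "h n"] i1(3)[of 0] by (simp add: right_diff_distrib)
    also have "\<dots> \<le> (LINT x|lborel. \<bar>F1 x * (G1 (x - h n) - G1 x)\<bar>)" by (rule integral_abs_bound)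
    also have "\<dots> \<le> (LINT x|lborel. M * \<bar>G1 (x - h n) - G1 x\<bar>)"
    proof (rule integral_mono)
      show "integrable lborel (\<lambda>x. \<bar>F1 x * (G1 (x - h n) - G1 x)\<bar>)"
        using i1(3)[of "h n"] i1(3)[of 0] by (simp add: right_diff_distrib)
      show "integrable lborel (\<lambda>x. M * \<bar>G1 (x - h n) - G1 x\<bar>)"
        using iG1 integrable_lborel_translate[OF iG1] by simp
      show "\<bar>F1 x * (G1 (x - h n) - G1 x)\<bar> \<le> M * \<bar>G1 (x - h n) - G1 x\<bar>" for x
        using trunc_band_le(3)[OF M] by (auto simp: abs_mult F1_def intro!: mult_right_mono)
    qed
    also have "\<dots> < e / 5" using N[OF that] by simp
    finally show ?thesis
      using split[of "h n"] split[of 0] T1[of "h n"] T1[of 0] T2[of "h n"] T2[of 0]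
      unfolding real_norm_def abs_less_iff abs_le_iff diff_zero by linarith
  qed
  then show "\<exists>N. \<forall>n\<ge>N. norm ((LINT x|lborel. F x * G (x - h n)) - (LINT x|lborel. F x * G x)) < e" by blast
qed

section \<open>Smooth functions and mollifiers\<close>

lemma exp_inverse_over_power_tendsto_0:
  "((\<lambda>t::real. exp (- (1 / t)) / t ^ k) \<longlongrightarrow> 0) (at_right 0)"
  by real_asymp

text \<open>The classical flat function \<open>exp (- 1 / t)\<close> divided by
  \<open>t ^ k\<close>. The index makes the linear span of the family closed under
  differentiation.\<close>

definition flat_exp :: "nat \<Rightarrow> real \<Rightarrow> real" where
  "flat_exp k t = (if t > 0 then exp (- (1 / t)) / t ^ k else 0)"

lemma flat_exp_mult: "t * flat_exp (Suc k) t = flat_exp k t"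
  by (simp add: flat_exp_def)

text \<open>Only \<open>t = 0\<close> needs an argument: from the right the difference quotient is
  \<open>flat_exp (Suc k)\<close>, which tends to 0 because the exponential beats every
  power.\<close>

lemma flat_exp_has_derivative:
  "(flat_exp k has_real_derivative (flat_exp (k + 2) t - k * flat_exp (k + 1) t)) (at t)"
proof -
  consider "t > 0" | "t < 0" | "t = 0" by linarith
  then show ?thesis
  proof cases
    case 1
    have "((\<lambda>t. exp (- (1 / t)) / t ^ k) has_real_derivative (flat_exp (k + 2) t - k * flat_exp (k + 1) t)) (at t)"
      using 1 by (auto intro!: derivative_eq_intros simp: flat_exp_def field_simps power2_eq_square)
         (cases k; simp add: field_simps)
    moreover have "\<forall>\<^sub>F x in nhds t. exp (- (1 / x)) / x ^ k = flat_exp k x"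
      using eventually_nhds_in_open[of "{0<..}" t] 1 by (auto simp: flat_exp_def elim!: eventually_mono)
    ultimately show ?thesis
      by (subst DERIV_cong_ev[OF refl _ refl, symmetric])
  next
    case 2
    have "((\<lambda>t. 0) has_real_derivative (flat_exp (k + 2) t - k * flat_exp (k + 1) t)) (at t)"
      using 2 by (auto simp: flat_exp_def)
    moreover have "\<forall>\<^sub>F x in nhds t. 0 = flat_exp k x"
      using eventually_nhds_in_open[of "{..<0}" t] 2 by (auto simp: flat_exp_def elim!: eventually_mono)
    ultimately show ?thesis
      by (subst DERIV_cong_ev[OF refl _ refl, symmetric])
  next
    case 3
    have "((\<lambda>y. flat_exp k y / y) \<longlongrightarrow> 0) (at_right 0)"
      by (rule Lim_transform_eventually[OF exp_inverse_over_power_tendsto_0[of "Suc k"]])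
         (auto simp: eventually_at_filter flat_exp_def)
    moreover have "((\<lambda>y. flat_exp k y / y) \<longlongrightarrow> 0) (at_left 0)"
      by (rule Lim_transform_eventually[OF tendsto_const[of 0]])
         (auto simp: eventually_at_filter flat_exp_def)
    ultimately have "((\<lambda>y. flat_exp k y / y) \<longlongrightarrow> 0) (at 0)" by (simp add: filterlim_split_at)
    then show ?thesis unfolding 3 by (simp add: has_field_derivative_iff flat_exp_def)
  qed
qed

lemma frechet_derivative_worksI: "f differentiable (at x) \<Longrightarrow> (f has_derivative frechet_derivative f (at x)) (at x)"
  by (simp add: frechet_derivative_works)

lemma real_polynomial_function_frechet_derivative:
  assumes "real_polynomial_function P"
  shows "real_polynomial_function (\<lambda>x. frechet_derivative P (at x) i)"
  using assms
proof induction
  case (linear f)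
  then have "frechet_derivative f (at x) = f" for x
    by (rule frechet_derivative_at[OF bounded_linear_imp_has_derivative, symmetric])
  then show ?case by (simp add: real_polynomial_function.intros(2))
next
  case (const c)
  then show ?case by (simp add: real_polynomial_function.intros(2))
next
  case (add f g)
  have "f differentiable at x" "g differentiable at x" for x
    using add by (auto intro: differentiable_at_real_polynomial_function)
  then have "frechet_derivative (\<lambda>x. f x + g x) (at x) i = frechet_derivative f (at x) i + frechet_derivative g (at x) i" for x
    using fun_cong[OF frechet_derivative_at[OF has_derivative_add[OF
      frechet_derivative_worksI frechet_derivative_worksI]], of f x g i] by simp
  then show ?case using add by (simp add: real_polynomial_function.intros(3))
next
  case (mult f g)
  have "f differentiable at x" "g differentiable at x" for x
    using mult by (auto intro: differentiable_at_real_polynomial_function)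
  then have "frechet_derivative (\<lambda>x. f x * g x) (at x) i = f x * frechet_derivative g (at x) i + frechet_derivative f (at x) i * g x" for x
    using fun_cong[OF frechet_derivative_at[OF has_derivative_mult[OF
      frechet_derivative_worksI frechet_derivative_worksI]], of f x g i] by simp
  then show ?case using mult by (auto intro!: real_polynomial_function.intros(3,4))
qed

text \<open>Smoothness is coinductive, so a class closed under partial derivatives has to be
  exhibited: polynomials times \<open>flat_exp k (r - x \<bullet> x)\<close>, with \<open>k\<close>
  arbitrary.\<close>

lemma smooth_fun_radial_bump:
  fixes r c :: real
  shows "smooth_fun (\<lambda>x::'a::euclidean_space. c * flat_exp 0 (r - x \<bullet> x))"
proof -
  define S where "S = {\<lambda>x::'a. P x * flat_exp k (r - x \<bullet> x) |P k. real_polynomial_function P}"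
  have "(\<lambda>x::'a. c * flat_exp 0 (r - x \<bullet> x)) \<in> S"
    unfolding S_def by (rule CollectI, rule exI[of _ "\<lambda>_. c"], rule exI[of _ 0])
      (auto intro: real_polynomial_function.intros)
  moreover have "\<forall>g\<in>S. (\<forall>x. g differentiable (at x)) \<and> (\<forall>i\<in>Basis. (\<lambda>x. frechet_derivative g (at x) i) \<in> S)"
  proof
    fix g assume "g \<in> S"
    then obtain P k where P: "real_polynomial_function P" and g: "g = (\<lambda>x::'a. P x * flat_exp k (r - x \<bullet> x))"
      by (auto simp: S_def)
    have d: "(g has_derivative (\<lambda>h. P x * ((flat_exp (k + 2) (r - x \<bullet> x) - k * flat_exp (k + 1) (r - x \<bullet> x)) * (- (2 * (x \<bullet> h))))
        + frechet_derivative P (at x) h * flat_exp k (r - x \<bullet> x))) (at x)" for x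
    proof -
      have "P differentiable (at x)"
        using P by (rule differentiable_at_real_polynomial_function)
      then have "(P has_derivative frechet_derivative P (at x)) (at x)"
        by (simp add: frechet_derivative_works)
      moreover have "((\<lambda>x. flat_exp k (r - x \<bullet> x)) has_derivative
         (\<lambda>h. (flat_exp (k + 2) (r - x \<bullet> x) - k * flat_exp (k + 1) (r - x \<bullet> x)) * (- (2 * (x \<bullet> h))))) (at x)"
        by (rule has_derivative_compose[OF _ flat_exp_has_derivative[unfolded has_field_derivative_def]])
          (auto intro!: derivative_eq_intros simp: inner_commute)
      ultimately show ?thesis unfolding g by (rule has_derivative_mult)
    qed
    have "(\<lambda>x. frechet_derivative g (at x) i) \<in> S" if i: "i \<in> Basis" for i
    proof -
      define Q where "Q x = frechet_derivative P (at x) i" for x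
      have Q: "real_polynomial_function Q" "\<And>x. frechet_derivative P (at x) i = Q x"
        using real_polynomial_function_frechet_derivative[OF P] by (auto simp: Q_def[abs_def])
      \<comment> \<open>With \<open>t = r - x \<bullet> x\<close>, the terms in
        \<open>flat_exp k\<close> and \<open>flat_exp (k + 1)\<close> become \<open>t ^ 2\<close>
        and \<open>t\<close> times \<open>flat_exp (k + 2)\<close>, so one polynomial coefficient
        suffices.\<close>
      let ?R = "\<lambda>x. P x * (1 - k * (r - x \<bullet> x)) * (- (2 * (x \<bullet> i))) + Q x * (r - x \<bullet> x) ^ 2"
      have ip: "real_polynomial_function (\<lambda>x::'a. x \<bullet> x)" 
        by (subst euclidean_inner) (intro real_polynomial_function_sum real_polynomial_function.intros bounded_linear_inner_left finite_Basis)
      have "real_polynomial_function ?R"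
        by (intro real_polynomial_function.intros real_polynomial_function_diff real_polynomial_function_minus 
          real_polynomial_function_power P Q ip bounded_linear_inner_left)
      moreover have "frechet_derivative g (at x) i = ?R x * flat_exp (k + 2) (r - x \<bullet> x)" for x
      proof -
        define t where "t = r - x \<bullet> x"
        have 1: "flat_exp (k + 1) t = t * flat_exp (k + 2) t" using flat_exp_mult[of t "Suc k"] by simp
        have "flat_exp k t = t ^ 2 * flat_exp (k + 2) t"
          using flat_exp_mult[of t k] 1 by (simp add: power2_eq_square mult.assoc)
        note this 1
        then show ?thesis unfolding frechet_derivative_at[OF d[of x], symmetric] Q(2) t_def[symmetric]
          by (simp add: algebra_simps)
      qed
      ultimately show ?thesis unfolding S_def by auto
    qed
    moreover have "g differentiable (at x)" for x using d unfolding differentiable_def by blast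
    ultimately show "(\<forall>x. g differentiable (at x)) \<and> (\<forall>i\<in>Basis. (\<lambda>x. frechet_derivative g (at x) i) \<in> S)"
      by blast
  qed
  ultimately show ?thesis unfolding smooth_fun_def by blast
qed

lemma smooth_funD:
  assumes "smooth_fun f"
  shows "f differentiable (at x)" "i \<in> Basis \<Longrightarrow> smooth_fun (\<lambda>x. frechet_derivative f (at x) i)"
  using assms unfolding smooth_fun_def by blast+

lemma smooth_fun_continuous_on: "smooth_fun f \<Longrightarrow> continuous_on S f"
  by (intro continuous_at_imp_continuous_on ballI differentiable_imp_continuous_within smooth_funD(1))

lemma smooth_fun_measurable: "smooth_fun f \<Longrightarrow> f \<in> borel_measurable borel"
  by (intro borel_measurable_continuous_onI smooth_fun_continuous_on)

text \<open>The radial bump is positive exactly on the open ball of radius \<open>r\<close>. Its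
  integral is therefore nonzero, since that ball has positive volume, and can be normalised.\<close>

lemma exists_mollifier:
  fixes r :: real
  assumes r: "r > 0"
  obtains \<rho> :: "'a::euclidean_space \<Rightarrow> real" where "smooth_fun \<rho>" "\<And>x. \<rho> x \<ge> 0"
    "\<And>x. norm x \<ge> r \<Longrightarrow> \<rho> x = 0" "integrable lborel \<rho>" "(LINT x|lborel. \<rho> x) = 1"
proof -
  define \<phi> where "\<phi> x = flat_exp 0 (r\<^sup>2 - x \<bullet> x)" for x :: 'a
  have sm: "smooth_fun (\<lambda>x. c * \<phi> x)" for c
    unfolding \<phi>_def by (rule smooth_fun_radial_bump)
  have [measurable]: "\<phi> \<in> borel_measurable borel" using smooth_fun_measurable[OF sm[of 1]] by simp
  have nn: "\<phi> x \<ge> 0" for x by (simp add: \<phi>_def flat_exp_def)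
  have sq: "x \<bullet> x < r\<^sup>2 \<longleftrightarrow> norm x < r" for x :: 'a
    using r by (simp add: norm_lt_square)
  have z: "\<phi> x = 0" if "norm x \<ge> r" for x using sq[of x] that by (simp add: \<phi>_def flat_exp_def)
  have pos: "\<phi> x > 0" if "norm x < r" for x using sq[of x] that by (simp add: \<phi>_def flat_exp_def)
  have int: "integrable lborel \<phi>"
  proof (rule Bochner_Integration.integrable_bound)
    show "integrable lborel (indicator (ball 0 r) :: 'a \<Rightarrow> real)"
      using r by (simp add: integrable_indicator_iff emeasure_ball)
    have "\<phi> x \<le> indicator (ball 0 r) x" for x
      using z[of x] by (cases "norm x < r") (auto simp: \<phi>_def flat_exp_def indicator_def)
    then show "AE x in lborel. norm (\<phi> x) \<le> norm (indicator (ball 0 r) x :: real)" using nn by (intro AE_I2) simp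
  qed simp
  have "(LINT x|lborel. \<phi> x) \<noteq> 0"
  proof
    assume "(LINT x|lborel. \<phi> x) = 0"
    then have "AE x in lborel. \<phi> x = 0" using integral_nonneg_eq_0_iff_AE[OF int] nn by auto
    then have "AE x in lborel. x \<notin> ball (0::'a) r" by eventually_elim (use pos in force)
    then have "emeasure lborel (ball (0::'a) r) = 0"
      by (subst (asm) AE_iff_measurable[of "ball 0 r"]) auto
    moreover have "unit_ball_vol (real DIM('a)) * r ^ DIM('a) > 0" using r by simp
    ultimately show False using emeasure_ball[of r "0::'a"] r by (simp add: ennreal_eq_0_iff)
  qed
  moreover have "(LINT x|lborel. \<phi> x) \<ge> 0" using nn by simp
  ultimately have J: "(LINT x|lborel. \<phi> x) > 0" by simp
  show thesis
    by (rule that[OF sm[of "1 / (LINT x|lborel. \<phi> x)"]]) (use nn z int J in auto)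
qed

section \<open>Compactly supported smooth functions and differentiation under a convolution\<close>

lemma compact_support_bounded:
  fixes g :: "'a::euclidean_space \<Rightarrow> real"
  assumes g: "continuous_on UNIV g" and R: "\<forall>x. norm x > R \<longrightarrow> g x = 0"
  obtains B where "\<And>x. \<bar>g x\<bar> \<le> B"
proof -
  have "compact (g ` cball 0 R)"
    by (intro compact_continuous_image continuous_on_subset[OF g]) auto
  then obtain B where "\<And>y. y \<in> g ` cball 0 R \<Longrightarrow> norm y \<le> B"
    using compact_imp_bounded bounded_iff by metis
  \<comment> \<open>For \<open>R < 0\<close> the ball is empty and \<open>B\<close> is arbitrary;
    the maximum covers this case together with the points where \<open>g\<close> vanishes.\<close>
  then have "\<bar>g x\<bar> \<le> max B 0" for x
    using R[rule_format, of x] by (cases "norm x \<le> R") (fastforce simp: le_max_iff_disj)+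
  then show thesis using that by blast
qed

lemma compact_support_uniformly_continuous:
  fixes g :: "'a::euclidean_space \<Rightarrow> real"
  assumes g: "continuous_on UNIV g" and R: "\<forall>x. norm x > R \<longrightarrow> g x = 0" and e: "e > 0"
  obtains d where "d > 0" "\<And>x y. norm (x - y) < d \<Longrightarrow> \<bar>g x - g y\<bar> < e"
proof -
  \<comment> \<open>If two points are closer than 1 and one lies in the ball of radius
    \<open>R\<close>, both lie in the enlarged ball; if neither does, both values are 0.\<close>
  have "uniformly_continuous_on (cball 0 (R + 1)) g"
    by (intro compact_uniformly_continuous continuous_on_subset[OF g]) auto
  then obtain d where d: "d > 0" "\<And>x y. x \<in> cball 0 (R + 1) \<Longrightarrow> y \<in> cball 0 (R + 1) \<Longrightarrow> dist y x < d \<Longrightarrow> dist (g y) (g x) < e"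
    using e unfolding uniformly_continuous_on_def by metis
  show thesis
  proof (rule that[of "min d 1"])
    fix x y :: 'a assume xy: "norm (x - y) < min d 1"
    have "norm x \<le> norm y + norm (x - y)" "norm y \<le> norm x + norm (x - y)"
      by norm+
    then show "\<bar>g x - g y\<bar> < e"
      using d(2)[of y x] R[rule_format, of x] R[rule_format, of y] e xy
      by (cases "norm x \<le> R \<or> norm y \<le> R") (auto simp: dist_norm)
  qed (use d in auto)
qed

lemma frechet_derivative_eq_sum_partials:
  fixes f :: "'a::euclidean_space \<Rightarrow> real"
  assumes "f differentiable (at x)"
  shows "frechet_derivative f (at x) v = (\<Sum>i\<in>Basis. (v \<bullet> i) * frechet_derivative f (at x) i)"
proof -
  have l: "linear (frechet_derivative f (at x))"
    using assms by (rule linear_frechet_derivative)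
  have "frechet_derivative f (at x) v = frechet_derivative f (at x) (\<Sum>i\<in>Basis. (v \<bullet> i) *\<^sub>R i)"
    by (simp add: euclidean_representation)
  also have "\<dots> = (\<Sum>i\<in>Basis. (v \<bullet> i) * frechet_derivative f (at x) i)"
    using l by (simp add: linear_sum linear_cmul)
  finally show ?thesis .
qed

lemma partial_compact_support:
  fixes f :: "'a::euclidean_space \<Rightarrow> real"
  assumes R: "\<forall>x. norm x > R \<longrightarrow> f x = 0"
  shows "\<forall>x. norm x > R \<longrightarrow> frechet_derivative f (at x) i = 0"
proof (intro allI impI)
  fix x :: 'a assume x: "norm x > R"
  have op: "open {x::'a. norm x > R}" by (intro open_Collect_less continuous_intros)
  have "((\<lambda>_. 0) has_derivative (\<lambda>_. 0)) (at x)" by simp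
  then have "(f has_derivative (\<lambda>_. 0)) (at x)"
    by (rule has_derivative_transform_within_open[OF _ op]) (use x R in auto)
  then show "frechet_derivative f (at x) i = 0" by (simp add: frechet_derivative_at[symmetric])
qed

text \<open>The first-order remainder is controlled with one \<open>d\<close> for all base points
  \<open>z\<close>. This uniformity is needed under the convolution integral, where
  \<open>z = x - y\<close> runs through the whole space; it comes from uniform continuity of the
  partial derivatives.\<close>

lemma smooth_compact_support_uniform_linearization:
  fixes f :: "'a::euclidean_space \<Rightarrow> real"
  assumes f: "smooth_fun f" and R: "\<forall>x. norm x > R \<longrightarrow> f x = 0" and e: "e > 0"
  obtains d where "d > 0"
    "\<And>z w. norm w < d \<Longrightarrow> \<bar>f (z + w) - f z - frechet_derivative f (at z) w\<bar> \<le> e * norm w"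
proof -
  \<comment> \<open>Each of the \<open>DIM('a)\<close> partial derivatives may contribute an equal
    share to the operator norm of the difference of derivatives.\<close>
  let ?e = "e / DIM('a)"
  have e': "?e > 0" using e by simp
  have "\<exists>d>0. \<forall>x y. norm (x - y) < d \<longrightarrow> \<bar>frechet_derivative f (at x) i - frechet_derivative f (at y) i\<bar> < ?e"
    if i: "i \<in> Basis" for i
    using compact_support_uniformly_continuous[OF smooth_fun_continuous_on[OF smooth_funD(2)[OF f i]]
      partial_compact_support[OF R] e'] by metis
  then obtain d where d: "\<And>i. i \<in> Basis \<Longrightarrow> d i > 0"
    "\<And>i x y. i \<in> Basis \<Longrightarrow> norm (x - y) < d i \<Longrightarrow> \<bar>frechet_derivative f (at x) i - frechet_derivative f (at y) i\<bar> < ?e"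
    by metis
  define D where "D = Min (d ` Basis)"
  have D: "D > 0" "\<And>i. i \<in> Basis \<Longrightarrow> D \<le> d i" using d(1) by (auto simp: D_def)
  show thesis
  proof (rule that[OF D(1)])
    fix z w :: 'a assume w: "norm w < D"
    have "norm (f (z + w) - f z - frechet_derivative f (at z) (z + w - z)) \<le> norm (z + w - z) * e"
    proof (rule differentiable_bound_linearization[of z "z + w" "ball z D" f "\<lambda>x. frechet_derivative f (at x)" z e])
      show "z + t *\<^sub>R (z + w - z) \<in> ball z D" if "t \<in> {0..1}" for t
      proof -
        have "norm (t *\<^sub>R w) \<le> 1 * norm w" using that by (simp add: mult_left_le_one_le)
        then show ?thesis using w by (simp add: dist_norm)
      qed
      show "(f has_derivative frechet_derivative f (at x)) (at x within ball z D)" for x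
        using smooth_funD(1)[OF f, of x] by (meson frechet_derivative_works has_derivative_at_withinI)
      show "onorm (frechet_derivative f (at x) - frechet_derivative f (at z)) \<le> e" if "x \<in> ball z D" for x
      proof (rule onorm_le)
        fix v :: 'a
        have "frechet_derivative f (at x) v - frechet_derivative f (at z) v
          = (\<Sum>i\<in>Basis. (v \<bullet> i) * (frechet_derivative f (at x) i - frechet_derivative f (at z) i))"
          unfolding frechet_derivative_eq_sum_partials[OF smooth_funD(1)[OF f], of _ v]
          by (simp add: right_diff_distrib sum_subtractf)
        also have "norm \<dots> \<le> (\<Sum>i\<in>(Basis::'a set). norm v * ?e)"
        proof (rule sum_norm_le)
          fix i :: 'a assume i: "i \<in> Basis"
          have "norm (x - z) < d i" using that D(2)[OF i] by (simp add: dist_norm norm_minus_commute)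
          then show "norm ((v \<bullet> i) * (frechet_derivative f (at x) i - frechet_derivative f (at z) i)) \<le> norm v * ?e"
            unfolding norm_mult
            using less_imp_le[OF d(2)[OF i, of x z]] Basis_le_norm[OF i, of v] by (intro mult_mono) simp_all
        qed
        also have "\<dots> = e * norm v" by simp
        finally show "norm ((frechet_derivative f (at x) - frechet_derivative f (at z)) v) \<le> e * norm v" by simp
      qed
    qed (use D in auto)
    then show "\<bar>f (z + w) - f z - frechet_derivative f (at z) w\<bar> \<le> e * norm w"
      by (simp add: mult.commute)
  qed
qed

lemma integrable_convolution:
  fixes f W :: "'a::euclidean_space \<Rightarrow> real"
  assumes f: "continuous_on UNIV f" and R: "\<forall>x. norm x > R \<longrightarrow> f x = 0" and W: "integrable lborel W"
  shows "integrable lborel (\<lambda>y. f (x - y) * W y)"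
proof -
  obtain B where B: "\<And>x. \<bar>f x\<bar> \<le> B" using compact_support_bounded[OF f R] by blast
  have [measurable]: "f \<in> borel_measurable borel" using f by (rule borel_measurable_continuous_onI)
  show ?thesis
  proof (rule Bochner_Integration.integrable_bound)
    show "integrable lborel (\<lambda>y. B * W y)" using W by simp
    have "B \<ge> 0" using B[of 0] by simp
    then show "AE y in lborel. norm (f (x - y) * W y) \<le> norm (B * W y)"
      using B by (intro AE_I2) (auto simp: abs_mult intro!: mult_right_mono)
  qed (use W in measurable)
qed

text \<open>The uniform linearization of \<open>f\<close> is integrated against \<open>|W|\<close>;
  no regularity of \<open>W\<close> beyond integrability enters.\<close>

lemma convolution_has_derivative:
  fixes f W :: "'a::euclidean_space \<Rightarrow> real"
  assumes f: "smooth_fun f" and R: "\<forall>x. norm x > R \<longrightarrow> f x = 0" and W: "integrable lborel W"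
  shows "((\<lambda>x. LINT y|lborel. f (x - y) * W y) has_derivative
     (\<lambda>v. \<Sum>i\<in>Basis. (v \<bullet> i) * (LINT y|lborel. frechet_derivative f (at (x - y)) i * W y))) (at x)"
  unfolding has_derivative_at_alt
proof (intro conjI allI impI)
  show "bounded_linear (\<lambda>v. \<Sum>i\<in>Basis. (v \<bullet> i) * (LINT y|lborel. frechet_derivative f (at (x - y)) i * W y))"
    by (rule bounded_linear_sum) (rule bounded_linear_compose[OF bounded_linear_mult_left bounded_linear_inner_left])
  fix e :: real assume e: "e > 0"
  define J where "J = (LINT y|lborel. \<bar>W y\<bar>)"
  have J: "J \<ge> 0" by (simp add: J_def)
  \<comment> \<open>Adding 1 keeps the quotient meaningful when \<open>W\<close> vanishes almost
    everywhere.\<close>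
  have "e / (J + 1) > 0" using e J by simp
  then obtain d where d: "d > 0"
    "\<And>z w. norm w < d \<Longrightarrow> \<bar>f (z + w) - f z - frechet_derivative f (at z) w\<bar> \<le> e / (J + 1) * norm w"
    using smooth_compact_support_uniform_linearization[OF f R] by metis
  have if0: "integrable lborel (\<lambda>y. f (x - y) * W y)" for x
    by (rule integrable_convolution[OF smooth_fun_continuous_on[OF f] R W])
  have if1: "integrable lborel (\<lambda>y. frechet_derivative f (at (x - y)) i * W y)" if "i \<in> Basis" for i
    by (rule integrable_convolution[OF smooth_fun_continuous_on[OF smooth_funD(2)[OF f that]]
      partial_compact_support[OF R] W])
  have "norm ((LINT y|lborel. f (x' - y) * W y) - (LINT y|lborel. f (x - y) * W y)
      - (\<Sum>i\<in>Basis. ((x' - x) \<bullet> i) * (LINT y|lborel. frechet_derivative f (at (x - y)) i * W y)))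
      \<le> e * norm (x' - x)" if x': "norm (x' - x) < d" for x'
  proof -
    let ?r = "\<lambda>y. f (x' - y) - f (x - y) - frechet_derivative f (at (x - y)) (x' - x)"
    have s: "(\<lambda>y. frechet_derivative f (at (x - y)) (x' - x) * W y)
        = (\<lambda>y. \<Sum>i\<in>Basis. ((x' - x) \<bullet> i) * (frechet_derivative f (at (x - y)) i * W y))"
      unfolding frechet_derivative_eq_sum_partials[OF smooth_funD(1)[OF f], of _ "x' - x"]
      by (simp add: sum_distrib_right mult.assoc)
    have if2: "integrable lborel (\<lambda>y. ((x' - x) \<bullet> i) * (frechet_derivative f (at (x - y)) i * W y))"
      if "i \<in> Basis" for i
      using if1[OF that] by (rule integrable_mult_right)
    have i2: "integrable lborel (\<lambda>y. frechet_derivative f (at (x - y)) (x' - x) * W y)"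
      unfolding s using if2 by (rule Bochner_Integration.integrable_sum)
    have s2: "(LINT y|lborel. frechet_derivative f (at (x - y)) (x' - x) * W y)
       = (\<Sum>i\<in>Basis. ((x' - x) \<bullet> i) * (LINT y|lborel. frechet_derivative f (at (x - y)) i * W y))"
      unfolding s by (subst Bochner_Integration.integral_sum[OF if2]) simp_all
    have r: "(\<lambda>y. ?r y * W y) = (\<lambda>y. f (x' - y) * W y - f (x - y) * W y
        - frechet_derivative f (at (x - y)) (x' - x) * W y)"
      by (simp only: left_diff_distrib)
    have ir: "integrable lborel (\<lambda>y. ?r y * W y)"
      unfolding r by (intro Bochner_Integration.integrable_diff if0 i2)
    have "(LINT y|lborel. f (x' - y) * W y) - (LINT y|lborel. f (x - y) * W y)
      - (\<Sum>i\<in>Basis. ((x' - x) \<bullet> i) * (LINT y|lborel. frechet_derivative f (at (x - y)) i * W y))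
      = (LINT y|lborel. ?r y * W y)"
      unfolding s2[symmetric] r
      by (simp only: Bochner_Integration.integral_diff Bochner_Integration.integrable_diff if0 i2)
    also have "norm \<dots> \<le> (LINT y|lborel. norm (?r y * W y))" by (rule integral_norm_bound)
    also have "\<dots> \<le> (LINT y|lborel. e / (J + 1) * norm (x' - x) * \<bar>W y\<bar>)"
    proof (rule integral_mono)
      fix y
      have "x - y + (x' - x) = x' - y" by simp
      then have "\<bar>?r y\<bar> \<le> e / (J + 1) * norm (x' - x)" using d(2)[OF x', of "x - y"] by metis
      then show "norm (?r y * W y) \<le> e / (J + 1) * norm (x' - x) * \<bar>W y\<bar>"
        unfolding real_norm_def abs_mult by (rule mult_right_mono) simp
    next
      show "integrable lborel (\<lambda>y. norm (?r y * W y))" using ir by (rule integrable_norm)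
      show "integrable lborel (\<lambda>y. e / (J + 1) * norm (x' - x) * \<bar>W y\<bar>)" using W by simp
    qed
    also have "\<dots> = e * norm (x' - x) * (J / (J + 1))" by (simp add: J_def)
    also have "\<dots> \<le> e * norm (x' - x) * 1"
      using J e by (intro mult_left_mono) auto
    finally show ?thesis by simp
  qed
  then show "\<exists>d>0. \<forall>x'. norm (x' - x) < d \<longrightarrow> norm ((LINT y|lborel. f (x' - y) * W y) - (LINT y|lborel. f (x - y) * W y)
      - (\<Sum>i\<in>Basis. ((x' - x) \<bullet> i) * (LINT y|lborel. frechet_derivative f (at (x - y)) i * W y)))
      \<le> e * norm (x' - x)" using d(1) by blast
qed

text \<open>The coinductive class consists of the convolutions of the fixed \<open>W\<close> with
  all smooth functions supported in the same ball: a partial derivative falls on the smooth factor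
  and leaves its support inside that ball.\<close>

lemma smooth_fun_convolution:
  fixes f W :: "'a::euclidean_space \<Rightarrow> real"
  assumes f: "smooth_fun f" and R: "\<forall>x. norm x > R \<longrightarrow> f x = 0" and W: "integrable lborel W"
  shows "smooth_fun (\<lambda>x. LINT y|lborel. f (x - y) * W y)"
  unfolding smooth_fun_def
proof (intro exI conjI ballI allI)
  let ?S = "{\<lambda>x. LINT y|lborel. f (x - y) * W y |f. smooth_fun f \<and> (\<forall>x. norm x > R \<longrightarrow> f x = 0)}"
  show "(\<lambda>x. LINT y|lborel. f (x - y) * W y) \<in> ?S" using f R by blast
  fix g assume "g \<in> ?S"
  then obtain f where f: "smooth_fun f" and R: "\<forall>x. norm x > R \<longrightarrow> f x = 0"
    and g: "g = (\<lambda>x. LINT y|lborel. f (x - y) * W y)" by blast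
  note D = convolution_has_derivative[OF f R W, folded g]
  show "g differentiable (at x)" for x using D unfolding differentiable_def by blast
  fix i :: 'a assume i: "i \<in> Basis"
  have delta: "(\<Sum>j\<in>Basis. (i \<bullet> j) * c j) = c i" for c :: "'a \<Rightarrow> real"
  proof -
    have "(\<Sum>j\<in>Basis. (i \<bullet> j) * c j) = (\<Sum>j\<in>Basis. if i = j then c j else 0)"
      using i by (intro sum.cong) (auto simp: inner_Basis)
    then show ?thesis using i by simp
  qed
  have "frechet_derivative g (at x) i = (LINT y|lborel. frechet_derivative f (at (x - y)) i * W y)" for x
    using fun_cong[OF frechet_derivative_at[OF D[of x]], of i] by (simp add: delta)
  then show "(\<lambda>x. frechet_derivative g (at x) i) \<in> ?S"
    using smooth_funD(2)[OF f i] partial_compact_support[OF R] by auto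
qed

section \<open>Integrals of truncated kernels\<close>

lemma dyadic_bracket:
  fixes x :: real
  assumes "1 \<le> x"
  obtains k :: nat where "2 ^ k \<le> x" "x \<le> 2 ^ Suc k"
proof -
  obtain n where n: "x < 2 ^ n" using real_arch_pow[of 2 x] by auto
  define m where "m = (LEAST n. x < 2 ^ n)"
  have m: "x < 2 ^ m" unfolding m_def using n by (rule LeastI)
  obtain k where k: "m = Suc k" using m assms by (cases m) auto
  have "\<not> x < 2 ^ k" using not_less_Least[of k "\<lambda>n. x < 2 ^ n"] k unfolding m_def[symmetric] by simp
  then show thesis using m k that[of k] by simp
qed

lemma suminf_ge_term:
  fixes f :: "nat \<Rightarrow> ennreal"
  shows "f k \<le> (\<Sum>k. f k)"
  using sum_le_suminf[of f "{k}"] by simp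

text \<open>The truncated factor is the oscillation bound for the later cutoff, with
  \<open>a\<close> the distance to the complement. For \<open>|x - y| \<le> a\<close> its
  \<open>p\<close>-th power compensates the singularity because \<open>s < 1\<close>; farther away
  the kernel decays because \<open>s > 0\<close>. Dyadic shells give two geometric series, with
  ratios \<open>r1\<close> and \<open>r2\<close>.\<close>

lemma nn_integral_truncated_kernel:
  fixes s p :: real
  assumes s: "0 < s" "s < 1" and p: "1 < p"
  obtains C where "C \<ge> 0" "\<And>a (x :: 'a::euclidean_space). a > 0 \<Longrightarrow>
    (\<integral>\<^sup>+y. ennreal (min 1 (4 * norm (x - y) / a) powr p / norm (x - y) powr (real DIM('a) + s * p)) \<partial>lborel)
      \<le> ennreal (C * a powr (- (s * p)))"
proof -
  define d where "d = DIM('a)"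
  define q where "q = real d + s * p"
  define V where "V = unit_ball_vol (real d)"
  have V: "V \<ge> 0" by (simp add: V_def)
  define r1 where "r1 = 2 powr (s * p - p)"
  define r2 where "r2 = 2 powr (- (s * p))"
  have sp: "0 < s * p" "s * p < p" using s p by auto
  have r: "0 < r1" "r1 < 1" "0 < r2" "r2 < 1"
    using sp powr_less_mono[of "s * p - p" 0 2] powr_less_mono[of "- (s * p)" 0 2] by (auto simp: r1_def r2_def)
  \<comment> \<open>In \<open>A1\<close>, \<open>4 powr p\<close> comes from the truncated factor
    and \<open>2 powr q\<close> from the inner radius of a shell; in \<open>A2\<close>,
    \<open>2 ^ d\<close> comes from the outer radius.\<close>
  define A1 where "A1 = 4 powr p * 2 powr q * V"
  define A2 where "A2 = 2 ^ d * V"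
  have A: "A1 \<ge> 0" "A2 \<ge> 0" using V by (auto simp: A1_def A2_def)
  have main: "(\<integral>\<^sup>+y. ennreal (min 1 (4 * norm (x - y) / a) powr p / norm (x - y) powr q) \<partial>lborel)
      \<le> ennreal ((A1 / (1 - r1) + A2 / (1 - r2)) * a powr (- (s * p)))" if a: "a > 0" for a and x :: 'a
  proof -
    \<comment> \<open>\<open>u k\<close> bounds the integrand on the shell between the radii
      \<open>a / 2 ^ Suc k\<close> and \<open>a / 2 ^ k\<close>, and \<open>v k\<close> does so on
      the shell between \<open>a * 2 ^ k\<close> and \<open>a * 2 ^ Suc k\<close>. Enlarging each
      shell to its full ball costs only a constant and gives explicit volumes.\<close>
    define u where "u k = (4 / 2 ^ k) powr p * (a / 2 ^ Suc k) powr (- q)" for k :: nat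
    define v where "v k = (a * 2 ^ k) powr (- q)" for k :: nat
    define U where "U k y = ennreal (u k) * indicator (cball x (a / 2 ^ k)) y" for k and y :: 'a
    define W where "W k y = ennreal (v k) * indicator (cball x (a * 2 ^ Suc k)) y" for k and y :: 'a
    have [measurable]: "U k \<in> borel_measurable borel" "W k \<in> borel_measurable borel" for k
      unfolding U_def W_def by (auto intro!: borel_measurable_times_ennreal borel_measurable_indicator)
    have le: "ennreal (min 1 (4 * norm (x - y) / a) powr p / norm (x - y) powr q) \<le> (\<Sum>k. U k y) + (\<Sum>k. W k y)" for y
    proof -
      define t where "t = norm (x - y)"
      have tnn: "t \<ge> 0" by (simp add: t_def)
      consider "t = 0" | "0 < t" "t \<le> a" | "a \<le> t" using tnn by linarith
      then have "ennreal (min 1 (4 * t / a) powr p / t powr q) \<le> (\<Sum>k. U k y) + (\<Sum>k. W k y)"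
      proof cases
        \<comment> \<open>On the diagonal the numerator is 0, hence so is the integrand.\<close>
        case 1 then show ?thesis by simp
      next
        case 2
        then have "1 \<le> a / t" by simp
        then obtain k where k: "2 ^ k \<le> a / t" "a / t \<le> 2 ^ Suc k" by (rule dyadic_bracket)
        have k': "t \<le> a / 2 ^ k" "a / 2 ^ Suc k \<le> t" using k 2 a by (auto simp: field_simps)
        have "4 * t / a \<le> 4 / 2 ^ k" using k'(1) a by (simp add: field_simps)
        then have "min 1 (4 * t / a) powr p \<le> (4 / 2 ^ k) powr p"
          using 2 a p by (intro powr_mono2) auto
        moreover have "t powr (- q) \<le> (a / 2 ^ Suc k) powr (- q)"
          using k'(2) 2 a sp by (intro powr_mono2') (auto simp: q_def)
        ultimately have "min 1 (4 * t / a) powr p * t powr (- q) \<le> u k"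
          unfolding u_def by (intro mult_mono) auto
        then have "ennreal (min 1 (4 * t / a) powr p / t powr q) \<le> ennreal (u k)"
          by (simp add: powr_minus divide_inverse ennreal_leI)
        also have "\<dots> = U k y" using k'(1) by (simp add: U_def t_def dist_norm)
        also have "\<dots> \<le> (\<Sum>k. U k y)" by (rule suminf_ge_term)
        finally show ?thesis by (simp add: add_increasing2)
      next
        case 3
        then have "1 \<le> t / a" using a by simp
        then obtain k where k: "2 ^ k \<le> t / a" "t / a \<le> 2 ^ Suc k" by (rule dyadic_bracket)
        have k': "t \<le> a * 2 ^ Suc k" "a * 2 ^ k \<le> t" using k a by (auto simp: field_simps)
        have "min 1 (4 * t / a) powr p \<le> 1 powr p"
          using 3 a p by (intro powr_mono2) auto
        moreover have "t powr (- q) \<le> v k" unfolding v_def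
          using k'(2) a sp by (intro powr_mono2') (auto simp: q_def)
        ultimately have "min 1 (4 * t / a) powr p * t powr (- q) \<le> 1 * v k"
          by (intro mult_mono) auto
        then have "ennreal (min 1 (4 * t / a) powr p / t powr q) \<le> ennreal (v k)"
          by (simp add: powr_minus divide_inverse ennreal_leI)
        also have "\<dots> = W k y" using k'(1) by (simp add: W_def t_def dist_norm)
        also have "\<dots> \<le> (\<Sum>k. W k y)" by (rule suminf_ge_term)
        finally show ?thesis by (simp add: add_increasing)
      qed
      then show ?thesis by (simp add: t_def)
    qed
    have IU: "(\<integral>\<^sup>+y. U k y \<partial>lborel) = ennreal (A1 * a powr (- (s * p)) * r1 ^ k)" for k
    proof -
      have "(\<integral>\<^sup>+y. U k y \<partial>lborel) = ennreal (u k) * ennreal (V * (a / 2 ^ k) ^ d)"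
        unfolding U_def using a by (subst nn_integral_cmult_indicator) (auto simp: emeasure_cball V_def d_def)
      also have "\<dots> = ennreal (u k * (V * (a / 2 ^ k) ^ d))"
        using V a by (intro ennreal_mult[symmetric]) (auto simp: u_def)
      also have "u k * (V * (a / 2 ^ k) ^ d) = A1 * a powr (- (s * p)) * r1 ^ k"
      proof -
        have e: "(2::real) ^ k = 2 powr k" "(2::real) ^ Suc k = 2 powr (k + 1)"
          by (simp_all add: powr_realpow powr_add)
        have "u k = 4 powr p * 2 powr (- (k * p)) * (a powr (- q) * 2 powr ((k + 1) * q))"
          unfolding u_def e using a by (simp add: powr_divide powr_powr powr_minus divide_inverse powr_mult inverse_powr)
        moreover have "(a / 2 ^ k) ^ d = a powr d * 2 powr (- (k * d))"
          unfolding e using a by (simp add: powr_realpow[symmetric] powr_powr powr_minus divide_inverse powr_mult inverse_powr)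
        moreover have "r1 ^ k = 2 powr (k * (s * p - p))"
          unfolding r1_def by (simp add: powr_realpow[symmetric] powr_powr mult.commute)
        moreover have "a powr (- q) * a powr d = a powr (- (s * p))"
          by (simp add: powr_add[symmetric] q_def)
        moreover have "2 powr (- (k * p)) * 2 powr ((k + 1) * q) * 2 powr (- (k * d)) = 2 powr q * 2 powr (k * (s * p - p))"
          by (simp add: powr_add[symmetric] q_def algebra_simps)
        ultimately show ?thesis unfolding A1_def by (simp add: mult_ac)
      qed
      finally show ?thesis .
    qed
    have IW: "(\<integral>\<^sup>+y. W k y \<partial>lborel) = ennreal (A2 * a powr (- (s * p)) * r2 ^ k)" for k
    proof -
      have "(\<integral>\<^sup>+y. W k y \<partial>lborel) = ennreal (v k) * ennreal (V * (a * 2 ^ Suc k) ^ d)"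
        unfolding W_def using a by (subst nn_integral_cmult_indicator) (auto simp: emeasure_cball V_def d_def)
      also have "\<dots> = ennreal (v k * (V * (a * 2 ^ Suc k) ^ d))"
        using V a by (intro ennreal_mult[symmetric]) (auto simp: v_def)
      also have "v k * (V * (a * 2 ^ Suc k) ^ d) = A2 * a powr (- (s * p)) * r2 ^ k"
      proof -
        have e: "(2::real) ^ k = 2 powr k" by (simp add: powr_realpow)
        have "v k = a powr (- q) * 2 powr (- (k * q))"
          unfolding v_def e using a by (simp add: powr_mult powr_powr)
        moreover have "(a * 2 ^ Suc k) ^ d = a powr d * 2 ^ d * 2 powr (k * d)"
          using a unfolding power_Suc e by (simp add: powr_realpow[symmetric] powr_mult powr_powr)
        moreover have "r2 ^ k = 2 powr (- (k * (s * p)))"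
          unfolding r2_def by (simp add: powr_realpow[symmetric] powr_powr mult.commute)
        moreover have "a powr (- q) * a powr d = a powr (- (s * p))"
          by (simp add: powr_add[symmetric] q_def)
        moreover have "2 powr (- (k * q)) * 2 powr (k * d) = 2 powr (- (k * (s * p)))"
          by (simp add: powr_add[symmetric] q_def algebra_simps)
        ultimately show ?thesis unfolding A2_def by (simp add: mult_ac)
      qed
      finally show ?thesis .
    qed
    have geo: "(\<Sum>k. ennreal (B * r ^ k)) = ennreal (B / (1 - r))" if "B \<ge> 0" "0 < r" "r < 1" for B r :: real
    proof (rule suminf_ennreal_eq)
      show "(\<lambda>k. B * r ^ k) sums (B / (1 - r))"
        using sums_mult[OF geometric_sums[of r], of B] that by simp
    qed (use that in auto)
    have "(\<integral>\<^sup>+y. ennreal (min 1 (4 * norm (x - y) / a) powr p / norm (x - y) powr q) \<partial>lborel)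
       \<le> (\<integral>\<^sup>+y. (\<Sum>k. U k y) + (\<Sum>k. W k y) \<partial>lborel)"
      by (intro nn_integral_mono le)
    also have "\<dots> = (\<Sum>k. \<integral>\<^sup>+y. U k y \<partial>lborel) + (\<Sum>k. \<integral>\<^sup>+y. W k y \<partial>lborel)"
      by (subst nn_integral_add) (auto simp: nn_integral_suminf)
    also have "\<dots> = ennreal (A1 * a powr (- (s * p)) / (1 - r1)) + ennreal (A2 * a powr (- (s * p)) / (1 - r2))"
      unfolding IU IW using A r by (subst (1 2) geo) auto
    also have "\<dots> = ennreal ((A1 / (1 - r1) + A2 / (1 - r2)) * a powr (- (s * p)))"
      using A r by (subst ennreal_plus[symmetric]) (auto simp: distrib_right)
    finally show ?thesis .
  qed
  show thesis
    by (rule that[of "A1 / (1 - r1) + A2 / (1 - r2)"]) (use A r main in \<open>auto simp: q_def d_def\<close>)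
qed

section \<open>Exterior balls of smooth domains\<close>

text \<open>Near \<open>x0\<close> the function \<open>\<rho>\<close> increases strictly along all
  directions close to a fixed \<open>e\<close>. Starting at a frontier point, where
  \<open>\<rho>\<close> is nonnegative, such a direction leads to \<open>\<rho> > 0\<close>, that
  is, out of \<Omega>. The balls of radius \<open>r t\<close> about \<open>x + t e\<close> lie in
  the resulting exterior cone.\<close>

lemma exterior_cone_local:
  fixes \<rho> :: "'a::euclidean_space \<Rightarrow> real"
  assumes om: "open \<Omega>" and U: "open U" "x0 \<in> U" and sm: "smooth_fun \<rho>"
    and nz: "frechet_derivative \<rho> (at x0) \<noteq> (\<lambda>_. 0)" and loc: "\<Omega> \<inter> U = {x \<in> U. \<rho> x < 0}"
  obtains e r where "norm e = 1" "0 < r" "r \<le> 1"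
    "\<And>x t. x \<in> frontier \<Omega> \<Longrightarrow> x \<in> ball x0 (r / 2) \<Longrightarrow> 0 < t \<Longrightarrow> t \<le> r / 8 \<Longrightarrow> ball (x + t *\<^sub>R e) (r * t) \<inter> \<Omega> = {}"
proof -
  let ?D = "\<lambda>x. frechet_derivative \<rho> (at x)"
  have lin: "linear (?D x)" for x using smooth_funD(1)[OF sm] by (rule linear_frechet_derivative)
  obtain v where v: "?D x0 v \<noteq> 0" using nz by auto
  then have v0: "v \<noteq> 0" using linear_0[OF lin] by auto
  \<comment> \<open>A direction with nonzero derivative, normalised and with its sign chosen so that
    \<open>\<rho>\<close> increases.\<close>
  define e where "e = (sgn (?D x0 v) / norm v) *\<^sub>R v"
  have e1: "norm e = 1" using v v0 by (simp add: e_def abs_sgn_eq)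
  have "?D x0 e = \<bar>?D x0 v\<bar> / norm v"
    unfolding e_def linear_cmul[OF lin] by (simp add: abs_sgn mult.commute)
  then have epos: "?D x0 e > 0" using v v0 by simp
  \<comment> \<open>Expansion into partial derivatives makes the derivative jointly continuous in
    point and direction, so positivity persists near \<open>(x0, e)\<close> in both.\<close>
  have "continuous_on UNIV (\<lambda>z. \<Sum>i\<in>Basis. (snd z \<bullet> i) * ?D (fst z) i)"
    by (intro continuous_intros continuous_on_compose2[OF smooth_fun_continuous_on[OF smooth_funD(2)[OF sm]]]) auto
  also have "(\<lambda>z. \<Sum>i\<in>Basis. (snd z \<bullet> i) * ?D (fst z) i) = (\<lambda>z. ?D (fst z) (snd z))"
    by (rule ext) (rule frechet_derivative_eq_sum_partials[OF smooth_funD(1)[OF sm], symmetric])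
  finally have "open {z. 0 < ?D (fst z) (snd z)}"
    by (intro open_Collect_less continuous_on_const)
  moreover have "(x0, e) \<in> {z. 0 < ?D (fst z) (snd z)}" using epos by simp
  ultimately obtain A B where AB: "open A" "open B" "(x0, e) \<in> A \<times> B" "A \<times> B \<subseteq> {z. 0 < ?D (fst z) (snd z)}"
    by (rule open_prod_elim)
  have "open (A \<inter> U)" "x0 \<in> A \<inter> U" "e \<in> B" using AB U by auto
  then obtain r1 r2 where r12: "r1 > 0" "ball x0 r1 \<subseteq> A \<inter> U" "r2 > 0" "ball e r2 \<subseteq> B"
    using AB(2) open_contains_ball by metis
  \<comment> \<open>One number serves both as the size of the neighbourhood of \<open>x0\<close> and
    as the opening of the cone about \<open>e\<close>.\<close>
  define r where "r = min 1 (min r1 r2)"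
  have r: "0 < r" "r \<le> 1" using r12 by (auto simp: r_def)
  have "ball x0 r \<subseteq> ball x0 r1" by (rule subset_ball) (simp add: r_def)
  then have rU: "ball x0 r \<subseteq> U" using r12(2) by blast
  have pos: "0 < ?D x e'" if "x \<in> ball x0 r" "e' \<in> ball e r" for x e'
  proof -
    have "x \<in> ball x0 r1" "e' \<in> ball e r2" using that unfolding r_def mem_ball by linarith+
    then have "(x, e') \<in> A \<times> B" using r12 by blast
    then have "(x, e') \<in> {z. 0 < ?D (fst z) (snd z)}" using AB(4) by (rule rev_subsetD)
    then show ?thesis by simp
  qed
  show thesis
  proof (rule that[OF e1 r])
    fix x t assume x: "x \<in> frontier \<Omega>" "x \<in> ball x0 (r / 2)" and t: "0 < t" "t \<le> r / 8"
    have "x \<notin> \<Omega>" using x(1) om by (simp add: frontier_def interior_open)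
    moreover have "x \<in> U" using x(2) rU r by auto
    ultimately have \<rho>x: "\<rho> x \<ge> 0" using loc by (metis (no_types, lifting) Int_iff mem_Collect_eq not_le)
    have "y \<notin> \<Omega>" if y: "y \<in> ball (x + t *\<^sub>R e) (r * t)" for y
    proof -
      \<comment> \<open>Rescaling by \<open>t\<close> turns the ball about \<open>x + t e\<close>
        into the ball of radius \<open>r\<close> about the direction \<open>e\<close>.\<close>
      define e' where "e' = (y - x) /\<^sub>R t"
      have ye: "y = x + t *\<^sub>R e'" using t by (simp add: e'_def)
      have "t * norm (e - e') = norm (t *\<^sub>R (e - e'))" using t by simp
      also have "\<dots> = dist (x + t *\<^sub>R e) y" unfolding ye dist_norm by (simp add: algebra_simps)
      also have "\<dots> < t * r" using y by (simp add: mult.commute)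
      finally have e': "e' \<in> ball e r" using t by (simp add: dist_norm)
      have ne': "norm e' \<le> 2"
      proof -
        have "norm e' \<le> norm e + norm (e' - e)" by norm
        then show ?thesis using e' e1 r by (simp add: dist_norm norm_minus_commute)
      qed
      \<comment> \<open>The bound \<open>r / 8\<close> is used here: \<open>x\<close> is within
        \<open>r / 2\<close> of \<open>x0\<close>, and the segment has length at most
        \<open>2 t \<le> r / 4\<close>.\<close>
      have inb: "x + s *\<^sub>R e' \<in> ball x0 r" if "0 \<le> s" "s \<le> t" for s
      proof -
        have "norm (s *\<^sub>R e') \<le> t * 2" using that ne' by (simp add: mult_mono)
        moreover have "dist x0 (x + s *\<^sub>R e') \<le> dist x0 x + norm (s *\<^sub>R e')"
          using dist_triangle[of x0 "x + s *\<^sub>R e'" x] by (simp add: dist_norm)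
        ultimately show ?thesis using x(2) t r by simp
      qed
      have "\<rho> (x + 0 *\<^sub>R e') < \<rho> (x + t *\<^sub>R e')"
      proof (rule DERIV_pos_imp_increasing[OF t(1)])
        fix s assume s: "0 \<le> s" "s \<le> t"
        have "((\<lambda>s. \<rho> (x + s *\<^sub>R e')) has_derivative (\<lambda>h. ?D (x + s *\<^sub>R e') (h *\<^sub>R e'))) (at s)"
          by (rule has_derivative_compose[OF _ frechet_derivative_worksI[OF smooth_funD(1)[OF sm]]])
            (auto intro!: derivative_eq_intros)
        then have "((\<lambda>s. \<rho> (x + s *\<^sub>R e')) has_real_derivative ?D (x + s *\<^sub>R e') e') (at s)"
          unfolding has_field_derivative_def linear_cmul[OF lin] by (simp add: mult.commute[of _ "?D (x + s *\<^sub>R e') e'"])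
        then show "\<exists>y. ((\<lambda>s. \<rho> (x + s *\<^sub>R e')) has_real_derivative y) (at s) \<and> 0 < y"
          using pos[OF inb[OF s] e'] by (intro exI conjI)
      qed
      then have "\<rho> y > 0" using \<rho>x unfolding ye[symmetric] by simp
      moreover have "y \<in> U" using inb[of t, folded ye] t rU by auto
      ultimately show ?thesis using loc by (metis (no_types, lifting) Int_iff mem_Collect_eq not_less_iff_gr_or_eq)
    qed
    then show "ball (x + t *\<^sub>R e) (r * t) \<inter> \<Omega> = {}" by blast
  qed
qed

text \<open>The frontier is compact, so finitely many of the local cones suffice and the smallest
  opening works everywhere.\<close>

lemma bounded_smooth_domain_exterior_balls:
  fixes \<Omega> :: "'a::euclidean_space set"
  assumes dom: "bounded_smooth_domain \<Omega>"
  obtains \<delta> t0 where "0 < \<delta>" "\<delta> \<le> 1" "0 < t0"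
    "\<And>x t. x \<in> frontier \<Omega> \<Longrightarrow> 0 < t \<Longrightarrow> t \<le> t0 \<Longrightarrow> \<exists>z. dist x z \<le> t \<and> ball z (\<delta> * t) \<inter> \<Omega> = {}"
proof -
  have om: "open \<Omega>" and bd: "bounded \<Omega>"
    and loc: "\<forall>x0\<in>frontier \<Omega>. \<exists>U \<rho>. open U \<and> x0 \<in> U \<and> smooth_fun \<rho> \<and>
        (\<forall>x\<in>U. frechet_derivative \<rho> (at x) \<noteq> (\<lambda>_. 0)) \<and> \<Omega> \<inter> U = {x\<in>U. \<rho> x < 0}"
    using dom unfolding bounded_smooth_domain_def by - (elim conjE, assumption)+
  have "\<exists>e r. norm e = 1 \<and> 0 < r \<and> r \<le> 1 \<and> (\<forall>x t. x \<in> frontier \<Omega> \<longrightarrow> x \<in> ball x0 (r / 2) \<longrightarrow> 0 < t \<longrightarrow> t \<le> r / 8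
      \<longrightarrow> ball (x + t *\<^sub>R e) (r * t) \<inter> \<Omega> = {})" if fr: "x0 \<in> frontier \<Omega>" for x0
  proof -
    obtain U \<rho> where U: "open U" "x0 \<in> U" "smooth_fun \<rho>" "\<forall>x\<in>U. frechet_derivative \<rho> (at x) \<noteq> (\<lambda>_. 0)"
      "\<Omega> \<inter> U = {x\<in>U. \<rho> x < 0}"
      using bspec[OF loc fr] by (elim exE conjE)
    have "frechet_derivative \<rho> (at x0) \<noteq> (\<lambda>_. 0)" using U(2,4) by blast
    then show ?thesis
    proof (rule exterior_cone_local[OF om U(1-3) _ U(5)])
      fix e :: 'a and r :: real
      assume "norm e = 1" "0 < r" "r \<le> 1"
        and "\<And>x t. x \<in> frontier \<Omega> \<Longrightarrow> x \<in> ball x0 (r / 2) \<Longrightarrow> 0 < t \<Longrightarrow> t \<le> r / 8 \<Longrightarrow> ball (x + t *\<^sub>R e) (r * t) \<inter> \<Omega> = {}"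
      then show ?thesis by (intro exI[of _ e] exI[of _ r] conjI allI impI)
    qed
  qed
  then obtain e r where er: "\<And>x0. x0 \<in> frontier \<Omega> \<Longrightarrow> norm (e x0) = 1 \<and> 0 < r x0 \<and> r x0 \<le> 1 \<and>
      (\<forall>x t. x \<in> frontier \<Omega> \<longrightarrow> x \<in> ball x0 (r x0 / 2) \<longrightarrow> 0 < t \<longrightarrow> t \<le> r x0 / 8
      \<longrightarrow> ball (x + t *\<^sub>R e x0) (r x0 * t) \<inter> \<Omega> = {})"
    by metis
  have "compact (frontier \<Omega>)" using bd by (rule compact_frontier_bounded)
  then obtain C where C: "C \<subseteq> frontier \<Omega>" "finite C" "frontier \<Omega> \<subseteq> (\<Union>c\<in>C. ball c (r c / 2))"
    by (rule compactE_image[of _ "frontier \<Omega>" "\<lambda>c. ball c (r c / 2)"]) (use er in \<open>auto intro!: bexI\<close>)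
  \<comment> \<open>Inserting 1 keeps the minimum defined for empty \<open>C\<close> and yields
    \<open>m \<le> 1\<close>.\<close>
  define m where "m = Min (insert 1 (r ` C))"
  have m: "0 < m" "m \<le> 1" "\<And>c. c \<in> C \<Longrightarrow> m \<le> r c"
    using C er by (auto simp: m_def)
  show thesis
  proof (rule that[of m "m / 8"])
    fix x t assume x: "x \<in> frontier \<Omega>" and t: "0 < t" "t \<le> m / 8"
    obtain c where c: "c \<in> C" "x \<in> ball c (r c / 2)" using C x by blast
    have "c \<in> frontier \<Omega>" using c C by blast
    note er' = er[OF this]
    have "t \<le> r c / 8" using t m(3)[OF c(1)] by simp
    then have "ball (x + t *\<^sub>R e c) (r c * t) \<inter> \<Omega> = {}" using er' x c t by blast
    moreover have "ball (x + t *\<^sub>R e c) (m * t) \<subseteq> ball (x + t *\<^sub>R e c) (r c * t)"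
      using m(3)[OF c(1)] t by (intro subset_ball mult_right_mono) auto
    moreover have "dist x (x + t *\<^sub>R e c) \<le> t" using er' t by (simp add: dist_norm)
    ultimately show "\<exists>z. dist x z \<le> t \<and> ball z (m * t) \<inter> \<Omega> = {}" by blast
  qed (use m in auto)
qed

text \<open>If \<open>d\<close> is the distance from \<open>x\<close> to the complement, the
  exterior ball at the nearest complement point has volume of order \<open>d ^ DIM('a)\<close> and
  lies within \<open>3 d\<close> of \<open>x\<close>. The kernel on this ball alone contributes a
  multiple of \<open>d powr (- \<sigma>)\<close>.\<close>

lemma bounded_smooth_domain_exterior_kernel:
  fixes \<Omega> :: "'a::euclidean_space set"
  assumes dom: "bounded_smooth_domain \<Omega>" and q: "q = real DIM('a) + \<sigma>" "\<sigma> > 0"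
  obtains c where "c > 0" "\<And>x. x \<in> \<Omega> \<Longrightarrow> ennreal (c * infdist x (- \<Omega>) powr (- \<sigma>))
     \<le> (\<integral>\<^sup>+y. ennreal (1 / norm (x - y) powr q) * indicator (- \<Omega>) y \<partial>lborel)"
proof -
  have om: "open \<Omega>" and bd: "bounded \<Omega>"
    using dom by (auto simp: bounded_smooth_domain_def)
  have [measurable]: "\<Omega> \<in> sets borel" using om by simp
  have ne: "- \<Omega> \<noteq> {}" using bd not_bounded_UNIV by (metis compl_bot_eq double_compl)
  then obtain y0 where y0: "y0 \<in> - \<Omega>" by blast
  obtain M where M: "M > 0" "\<And>x. x \<in> \<Omega> \<Longrightarrow> norm x \<le> M" using bd bounded_pos by metis
  define D where "D = M + norm y0 + 1"
  have D: "D > 0" using M by (simp add: D_def add_pos_nonneg)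
  obtain \<delta> t0 where dt: "0 < \<delta>" "\<delta> \<le> 1" "0 < t0"
    and ext: "\<And>x t. x \<in> frontier \<Omega> \<Longrightarrow> 0 < t \<Longrightarrow> t \<le> t0 \<Longrightarrow> \<exists>z. dist x z \<le> t \<and> ball z (\<delta> * t) \<inter> \<Omega> = {}"
    using bounded_smooth_domain_exterior_balls[OF dom] by metis
  \<comment> \<open>Exterior balls exist only up to scale \<open>t0\<close>. Since distances to the
    complement are bounded by \<open>D\<close>, the scale \<open>\<kappa> d\<close> is always
    admissible, and it does not exceed \<open>d\<close>.\<close>
  define \<kappa> where "\<kappa> = min 1 (t0 / D)"
  have \<kappa>: "0 < \<kappa>" "\<kappa> \<le> 1" "\<kappa> * D \<le> t0" using D dt by (auto simp: \<kappa>_def min_def field_simps)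
  define V where "V = unit_ball_vol (real DIM('a))"
  have V: "V > 0" by (simp add: V_def)
  \<comment> \<open>The lower bound for the kernel at distance \<open>3 d\<close>, times the volume
    of a ball of radius \<open>\<delta> \<kappa> d\<close>, with the powers of \<open>d\<close>
    removed.\<close>
  define c where "c = 3 powr (- q) * (V * (\<delta> * \<kappa>) ^ DIM('a))"
  show thesis
  proof (rule that[of c])
    show "c > 0" using V dt \<kappa> by (simp add: c_def)
    fix x assume x: "x \<in> \<Omega>"
    define d where "d = infdist x (- \<Omega>)"
    obtain x1 where x1: "x1 \<in> - \<Omega>" "d = dist x x1"
      using infdist_attains_inf[of "- \<Omega>" x] om ne by (auto simp: d_def)
    have d0: "d > 0" using x1 x by auto
    have "d \<le> dist x y0" unfolding d_def using y0 by (rule infdist_le)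
    also have "\<dots> \<le> norm x + norm y0" unfolding dist_norm by (rule norm_triangle_ineq4)
    finally have dD: "d \<le> D" using M(2)[OF x] by (simp add: D_def)
    have "ball x d \<subseteq> \<Omega>"
    proof
      fix y assume y: "y \<in> ball x d"
      show "y \<in> \<Omega>"
      proof (rule ccontr)
        assume "y \<notin> \<Omega>"
        then have "d \<le> dist x y" unfolding d_def by (intro infdist_le) auto
        then show False using y by simp
      qed
    qed
    \<comment> \<open>The nearest point \<open>x1\<close> lies on the boundary of a ball contained
      in \<Omega>, hence in the closure of \<Omega>; being outside \<Omega>, it is a frontier
      point.\<close>
    then have "closure (ball x d) \<subseteq> closure \<Omega>" by (rule closure_mono)
    then have "x1 \<in> closure \<Omega>" using d0 x1 by auto
    then have fr: "x1 \<in> frontier \<Omega>" using x1 om by (simp add: frontier_def interior_open)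
    define t where "t = \<kappa> * d"
    have t: "0 < t" "t \<le> t0" "t \<le> d"
      using mult_pos_pos[OF \<kappa>(1) d0] \<kappa>(3) mult_left_mono[OF dD less_imp_le[OF \<kappa>(1)]]
        mult_right_mono[OF \<kappa>(2) less_imp_le[OF d0]]
      unfolding t_def mult_1 by linarith+
    obtain z where z: "dist x1 z \<le> t" "ball z (\<delta> * t) \<inter> \<Omega> = {}" using ext[OF fr t(1,2)] by blast
    have "c * d powr (- \<sigma>) = (3 * d) powr (- q) * (V * (\<delta> * t) ^ DIM('a))"
    proof -
      have "(3 * d) powr (- q) = 3 powr (- q) * d powr (- q)" using d0 by (simp add: powr_mult)
      moreover have "(\<delta> * t) ^ DIM('a) = (\<delta> * \<kappa>) ^ DIM('a) * d powr DIM('a)"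
        using d0 by (simp add: t_def powr_realpow power_mult_distrib)
      moreover have "d powr (- q) * d powr DIM('a) = d powr (- \<sigma>)"
        by (simp add: powr_add[symmetric] q)
      ultimately show ?thesis by (simp add: c_def mult_ac)
    qed
    also have "ennreal \<dots> = (\<integral>\<^sup>+y. ennreal ((3 * d) powr (- q)) * indicator (ball z (\<delta> * t)) y \<partial>lborel)"
      using V dt t by (subst nn_integral_cmult_indicator) (auto simp: emeasure_ball V_def ennreal_mult)
    also have "\<dots> \<le> (\<integral>\<^sup>+y. ennreal (1 / norm (x - y) powr q) * indicator (- \<Omega>) y \<partial>lborel)"
    proof (rule nn_integral_mono)
      fix y
      show "ennreal ((3 * d) powr (- q)) * indicator (ball z (\<delta> * t)) y \<le> ennreal (1 / norm (x - y) powr q) * indicator (- \<Omega>) y"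
      proof (cases "y \<in> ball z (\<delta> * t)")
        case True
        then have y: "y \<notin> \<Omega>" using z by blast
        then have nz: "norm (x - y) > 0" using x by auto
        have "\<delta> * t \<le> 1 * t" using dt t by (intro mult_right_mono) auto
        moreover have "dist x y \<le> dist x x1 + dist x1 z + dist z y"
          by (metis add.commute add_left_mono dist_triangle order_trans dist_triangle_le)
        ultimately have "dist x y \<le> 3 * d" using True z(1) x1(2) t unfolding mem_ball by linarith
        then have "norm (x - y) \<le> 3 * d" by (simp add: dist_norm)
        then have "(3 * d) powr (- q) \<le> norm (x - y) powr (- q)"
          using nz q by (intro powr_mono2') auto
        then show ?thesis using True y by (simp add: powr_minus divide_inverse ennreal_leI)
      qed auto
    qed
    finally show "ennreal (c * infdist x (- \<Omega>) powr (- \<sigma>))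
     \<le> (\<integral>\<^sup>+y. ennreal (1 / norm (x - y) powr q) * indicator (- \<Omega>) y \<partial>lborel)" unfolding d_def .
  qed
qed

section \<open>Mollified pairings\<close>

text \<open>The bound \<open>C\<close>, uniform in the shift, gives absolute integrability of the
  double integral. The map \<open>L\<close> allows two uses: diagonal shifts \<open>(h, h)\<close>
  for the energy and plain shifts for the source term.\<close>

lemma mollified_pairing_Fubini:
  fixes F G :: "'b::euclidean_space \<Rightarrow> real" and L :: "'a::euclidean_space \<Rightarrow> 'b" and \<rho> :: "'a \<Rightarrow> real"
  assumes [measurable]: "F \<in> borel_measurable borel" "G \<in> borel_measurable borel"
    and L: "continuous_on UNIV L"
    and int: "\<And>h. integrable lborel (\<lambda>z. F z * G (z - h))"
    and C: "\<And>h. (LINT z|lborel. \<bar>F z * G (z - h)\<bar>) \<le> C"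
    and \<rho>: "integrable lborel \<rho>"
  shows "(LINT z|lborel. F z * (LINT h|lborel. \<rho> h * G (z - L h)))
     = (LINT h|lborel. \<rho> h * (LINT z|lborel. F z * G (z - L h)))"
proof -
  have [measurable]: "L \<in> borel_measurable borel" using L by (rule borel_measurable_continuous_onI)
  have [measurable]: "\<rho> \<in> borel_measurable borel" using \<rho> by auto
  let ?f = "\<lambda>h z. \<rho> h * (F z * G (z - L h))"
  have m: "(\<lambda>(h, z). ?f h z) \<in> borel_measurable (lborel \<Otimes>\<^sub>M lborel)" by measurable
  have m2: "(\<lambda>h. LINT z|lborel. norm (?f h z)) \<in> borel_measurable lborel"
    by (rule lborel.borel_measurable_lebesgue_integral) measurable
  have "integrable (lborel \<Otimes>\<^sub>M lborel) (\<lambda>(h, z). ?f h z)"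
  proof (rule lborel_pair.Fubini_integrable[OF m])
    show "integrable lborel (\<lambda>h. LINT z|lborel. norm (case (h, z) of (h, z) \<Rightarrow> ?f h z))"
    proof (rule Bochner_Integration.integrable_bound)
      show "integrable lborel (\<lambda>h. C * \<rho> h)" using \<rho> by simp
      show "AE h in lborel. norm (LINT z|lborel. norm (case (h, z) of (h, z) \<Rightarrow> ?f h z)) \<le> norm (C * \<rho> h)"
      proof (rule AE_I2)
        fix h
        have "(LINT z|lborel. norm (?f h z)) = \<bar>\<rho> h\<bar> * (LINT z|lborel. \<bar>F z * G (z - L h)\<bar>)"
          by (simp add: abs_mult)
        also have "\<dots> \<le> \<bar>\<rho> h\<bar> * C" using C by (intro mult_left_mono) auto
        finally have "(LINT z|lborel. norm (?f h z)) \<le> \<bar>\<rho> h\<bar> * \<bar>C\<bar>"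
          by (rule order_trans) (intro mult_left_mono, auto)
        moreover have "(LINT z|lborel. norm (?f h z)) \<ge> 0" by simp
        ultimately show "norm (LINT z|lborel. norm (case (h, z) of (h, z) \<Rightarrow> ?f h z)) \<le> norm (C * \<rho> h)"
          by (simp add: abs_mult mult.commute)
      qed
    qed (use m2 in simp)
    show "AE h in lborel. integrable lborel (\<lambda>z. case (h, z) of (h, z) \<Rightarrow> ?f h z)"
      using int by (intro AE_I2) simp
  qed
  then have "(LINT z|lborel. LINT h|lborel. ?f h z) = (LINT h|lborel. LINT z|lborel. ?f h z)"
    by (rule lborel_pair.Fubini_integral)
  moreover have "(LINT h|lborel. ?f h z) = F z * (LINT h|lborel. \<rho> h * G (z - L h))" for z
  proof -
    have "(\<lambda>h. ?f h z) = (\<lambda>h. F z * (\<rho> h * G (z - L h)))" by (simp add: mult_ac)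
    then show ?thesis by simp
  qed
  ultimately show ?thesis by simp
qed

text \<open>An approximate identity evaluates a bounded measurable function at a point of
  continuity; continuity at 0 is the only regularity asked of \<open>H\<close>.\<close>

lemma mollifier_integral_tendsto:
  fixes H :: "'a::euclidean_space \<Rightarrow> real" and \<rho> :: "nat \<Rightarrow> 'a \<Rightarrow> real"
  assumes [measurable]: "H \<in> borel_measurable borel" and HC: "\<And>h. \<bar>H h\<bar> \<le> C"
    and cont: "\<And>h. h \<longlonglongrightarrow> 0 \<Longrightarrow> (\<lambda>n. H (h n)) \<longlonglongrightarrow> H 0"
    and \<rho>: "\<And>n. integrable lborel (\<rho> n)" "\<And>n x. \<rho> n x \<ge> 0" "\<And>n. (LINT x|lborel. \<rho> n x) = 1"
    and supp: "\<And>n x. norm x \<ge> r n \<Longrightarrow> \<rho> n x = 0" and r: "r \<longlonglongrightarrow> 0"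
  shows "(\<lambda>n. LINT h|lborel. \<rho> n h * H h) \<longlonglongrightarrow> H 0"
proof (rule LIMSEQ_I)
  fix e :: real assume e: "e > 0"
  have "continuous (at 0) H" unfolding continuous_at_sequentially using cont by (auto simp: o_def)
  then obtain d where d: "d > 0" "\<And>h. dist h 0 < d \<Longrightarrow> dist (H h) (H 0) < e / 2"
    unfolding continuous_at_eps_delta using e half_gt_zero by metis
  obtain N where N: "\<And>n. n \<ge> N \<Longrightarrow> r n < d"
    using order_tendstoD(2)[OF r d(1)] by (auto simp: eventually_sequentially)
  have "norm ((LINT h|lborel. \<rho> n h * H h) - H 0) < e" if "n \<ge> N" for n
  proof -
    have [measurable]: "\<rho> n \<in> borel_measurable borel" using \<rho>(1)[of n] by auto
    have i1: "integrable lborel (\<lambda>h. \<rho> n h * H h)"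
    proof (rule Bochner_Integration.integrable_bound)
      show "integrable lborel (\<lambda>h. C * \<rho> n h)" using \<rho>(1) by simp
      have "\<bar>\<rho> n h * H h\<bar> \<le> \<bar>C * \<rho> n h\<bar>" for h
        using HC[of h] unfolding abs_mult mult.commute[of "\<bar>C\<bar>"] by (intro mult_left_mono) auto
      then show "AE h in lborel. norm (\<rho> n h * H h) \<le> norm (C * \<rho> n h)" by simp
    qed simp
    have i2: "integrable lborel (\<lambda>h. \<rho> n h * H 0)" using \<rho>(1) by simp
    have "(LINT h|lborel. \<rho> n h * H h) - H 0 = (LINT h|lborel. \<rho> n h * H h - \<rho> n h * H 0)"
      using i1 i2 \<rho>(3) by simp
    also have "norm \<dots> \<le> (LINT h|lborel. norm (\<rho> n h * H h - \<rho> n h * H 0))"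
      by (rule integral_norm_bound)
    also have "\<dots> \<le> (LINT h|lborel. \<rho> n h * (e / 2))"
    proof (rule integral_mono)
      fix h
      show "norm (\<rho> n h * H h - \<rho> n h * H 0) \<le> \<rho> n h * (e / 2)"
      proof (cases "norm h < r n")
        case True
        then have "dist (H h) (H 0) < e / 2" using d(2)[of h] N[OF that] by simp
        then have "\<rho> n h * \<bar>H h - H 0\<bar> \<le> \<rho> n h * (e / 2)"
          using \<rho>(2)[of n h] by (intro mult_left_mono) (auto simp: dist_norm)
        then show ?thesis using \<rho>(2)[of n h] by (simp add: abs_mult flip: right_diff_distrib)
      qed (use supp in simp)
    qed (use i1 i2 \<rho>(1) in auto)
    also have "\<dots> < e" using \<rho>(3)[of n] e by simp
    finally show ?thesis .
  qed
  then show "\<exists>N. \<forall>n\<ge>N. norm ((LINT h|lborel. \<rho> n h * H h) - H 0) < e" by blast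
qed

text \<open>After the exchange of integrals, the mollifier acts on the scalar function that maps a
  shift to the shifted pairing. Hence weak continuity at shift 0 is enough.\<close>

lemma mollified_pairing_tendsto:
  fixes F G :: "'b::euclidean_space \<Rightarrow> real" and L :: "'a::euclidean_space \<Rightarrow> 'b" and \<rho> :: "nat \<Rightarrow> 'a \<Rightarrow> real"
  assumes [measurable]: "F \<in> borel_measurable borel" "G \<in> borel_measurable borel"
    and L: "continuous_on UNIV L" "L 0 = 0"
    and int: "\<And>h. integrable lborel (\<lambda>z. F z * G (z - h))"
    and C: "\<And>h. (LINT z|lborel. \<bar>F z * G (z - h)\<bar>) \<le> C"
    and cont: "\<And>h. h \<longlonglongrightarrow> 0 \<Longrightarrow> (\<lambda>n. LINT z|lborel. F z * G (z - h n)) \<longlonglongrightarrow> (LINT z|lborel. F z * G z)"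
    and \<rho>: "\<And>n. integrable lborel (\<rho> n)" "\<And>n x. \<rho> n x \<ge> 0" "\<And>n. (LINT x|lborel. \<rho> n x) = 1"
    and supp: "\<And>n x. norm x \<ge> r n \<Longrightarrow> \<rho> n x = 0" and r: "r \<longlonglongrightarrow> 0"
  shows "(\<lambda>n. LINT z|lborel. F z * (LINT h|lborel. \<rho> n h * G (z - L h))) \<longlonglongrightarrow> (LINT z|lborel. F z * G z)"
proof -
  have [measurable]: "L \<in> borel_measurable borel" using L(1) by (rule borel_measurable_continuous_onI)
  let ?H = "\<lambda>h. LINT z|lborel. F z * G (z - L h)"
  have "(\<lambda>n. LINT h|lborel. \<rho> n h * ?H h) \<longlonglongrightarrow> ?H 0"
  proof (rule mollifier_integral_tendsto[OF _ _ _ \<rho> supp r])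
    have "?H \<in> borel_measurable lborel"
      by (rule lborel.borel_measurable_lebesgue_integral) measurable
    then show "?H \<in> borel_measurable borel" by simp
    show "\<bar>?H h\<bar> \<le> C" for h
      by (rule order_trans[OF integral_abs_bound C])
    show "(\<lambda>n. ?H (h n)) \<longlonglongrightarrow> ?H 0" if "h \<longlonglongrightarrow> 0" for h
    proof -
      have "isCont L 0" using L(1) by (simp add: continuous_on_eq_continuous_at)
      then have "(\<lambda>n. L (h n)) \<longlonglongrightarrow> 0" using isCont_tendsto_compose[OF _ that] L(2) by metis
      then show ?thesis using cont L(2) by simp
    qed
  qed
  then show ?thesis
    using mollified_pairing_Fubini[OF assms(1,2) L(1) int C \<rho>(1)] L(2) by simp
qed

text \<open>The endpoint case of an integrable against a bounded function. Translation is not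
  continuous in the supremum norm, so the shift is moved onto \<open>f\<close>, where continuity in
  \<open>L\<^sup>1\<close> applies.\<close>

lemma bounded_translate_pairing:
  fixes f W :: "'a::euclidean_space \<Rightarrow> real"
  assumes f: "integrable lborel f" and [measurable]: "W \<in> borel_measurable borel" and M: "\<And>x. \<bar>W x\<bar> \<le> M"
  shows "integrable lborel (\<lambda>z. f z * W (z - h))"
    and "(LINT z|lborel. \<bar>f z * W (z - h)\<bar>) \<le> M * (LINT z|lborel. \<bar>f z\<bar>)"
    and "k \<longlonglongrightarrow> 0 \<Longrightarrow> (\<lambda>n. LINT z|lborel. f z * W (z - k n)) \<longlonglongrightarrow> (LINT z|lborel. f z * W z)"
proof -
  have [measurable]: "f \<in> borel_measurable borel" using f by auto
  have b: "\<bar>t * W x\<bar> \<le> M * \<bar>t\<bar>" for t x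
    using M[of x] unfolding abs_mult by (subst mult.commute) (intro mult_right_mono, auto)
  have M0: "M \<ge> 0" using M[of 0] by simp
  have int: "integrable lborel (\<lambda>z. g z * W (z - h))" if g: "integrable lborel g" for g h
  proof (rule Bochner_Integration.integrable_bound)
    show "integrable lborel (\<lambda>z. M * g z)" using g by simp
    show "AE z in lborel. norm (g z * W (z - h)) \<le> norm (M * g z)" using b M0 by (simp add: abs_mult)
  qed (use g in measurable)
  show "integrable lborel (\<lambda>z. f z * W (z - h))" by (rule int[OF f])
  show "(LINT z|lborel. \<bar>f z * W (z - h)\<bar>) \<le> M * (LINT z|lborel. \<bar>f z\<bar>)"
    using integral_mono[OF integrable_abs[OF int[OF f]], of "\<lambda>z. M * \<bar>f z\<bar>" h] b f by simp
  assume k: "k \<longlonglongrightarrow> 0"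
  have nk: "(\<lambda>n. - k n) \<longlonglongrightarrow> 0" using tendsto_minus[OF k] by simp
  have "(\<lambda>n. (LINT z|lborel. f z * W (z - k n)) - (LINT z|lborel. f z * W z)) \<longlonglongrightarrow> 0"
  proof (rule Lim_null_comparison)
    show "(\<lambda>n. M * (LINT z|lborel. \<bar>f (z - (- k n)) - f z\<bar>)) \<longlonglongrightarrow> 0"
      using tendsto_mult[OF tendsto_const translate_L1_tendsto_0[OF f nk], of M] by simp
    show "\<forall>\<^sub>F n in sequentially. norm ((LINT z|lborel. f z * W (z - k n)) - (LINT z|lborel. f z * W z))
       \<le> M * (LINT z|lborel. \<bar>f (z - (- k n)) - f z\<bar>)"
    proof (rule always_eventually, rule allI)
      fix n
      note ft = integrable_lborel_translate[OF f, of "- k n"]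
      \<comment> \<open>Change of variables transfers the shift from \<open>W\<close> to
        \<open>f\<close>, with opposite sign.\<close>
      have "(LINT z|lborel. f z * W (z - k n)) = (LINT z|lborel. f (z - (- k n)) * W z)"
        using integral_lborel_translate[of "\<lambda>z. f z * W (z - k n)" "- k n"] by simp
      then have "norm ((LINT z|lborel. f z * W (z - k n)) - (LINT z|lborel. f z * W z))
          = norm (LINT z|lborel. (f (z - (- k n)) - f z) * W z)"
        using int[OF ft, of 0] int[OF f, of 0] by (simp add: left_diff_distrib)
      also have "\<dots> \<le> (LINT z|lborel. norm ((f (z - (- k n)) - f z) * W z))" by (rule integral_norm_bound)
      also have "\<dots> \<le> (LINT z|lborel. M * \<bar>f (z - (- k n)) - f z\<bar>)"
        using int[OF Bochner_Integration.integrable_diff[OF ft f], of 0] ft f b by (intro integral_mono) auto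
      finally show "norm ((LINT z|lborel. f z * W (z - k n)) - (LINT z|lborel. f z * W z))
         \<le> M * (LINT z|lborel. \<bar>f (z - (- k n)) - f z\<bar>)" by simp
    qed
  qed
  then show "(\<lambda>n. LINT z|lborel. f z * W (z - k n)) \<longlonglongrightarrow> (LINT z|lborel. f z * W z)"
    by (simp add: LIM_zero_iff)
qed

section \<open>The weak equation for bounded Sobolev functions\<close>

lemma spow_abs: "\<bar>spow r X\<bar> = \<bar>X\<bar> powr r"
proof (cases "X = 0")
  case False
  then have "\<bar>X\<bar> powr (r - 1) * \<bar>X\<bar> = \<bar>X\<bar> powr r"
    using powr_mult_base[of "\<bar>X\<bar>" "r - 1"] by (simp add: mult.commute)
  then show ?thesis by (simp add: spow_def abs_mult)
qed (simp add: spow_def)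

lemma measurable_spow [measurable]: "spow r \<in> borel_measurable borel"
  unfolding spow_def[abs_def] by measurable

text \<open>The kernel \<open>|x - y|\<^bsup>-d-sp\<^esup>\<close> is split as \<open>|x - y|\<^bsup>-(d+sp)/p\<^esup> \<cdot> |x - y|\<^bsup>-(d+sp)(p-1)/p\<^esup>\<close>, so that the
  energy pairing becomes an unweighted pairing of an \<open>L\<^sup>p\<close> function with one in the dual space.\<close>
definition diff_quot :: "real \<Rightarrow> real \<Rightarrow> ('a::euclidean_space \<Rightarrow> real) \<Rightarrow> 'a \<times> 'a \<Rightarrow> real" where
  "diff_quot s p W z = (W (fst z) - W (snd z)) / norm (fst z - snd z) powr ((real DIM('a) + s * p) / p)"

definition dual_quot :: "real \<Rightarrow> real \<Rightarrow> ('a::euclidean_space \<Rightarrow> real) \<Rightarrow> 'a \<times> 'a \<Rightarrow> real" where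
  "dual_quot s p U z = spow (p - 1) (U (fst z) - U (snd z)) /
     norm (fst z - snd z) powr ((real DIM('a) + s * p) * ((p - 1) / p))"

text \<open>Only the seminorm is recorded, since the energy pairing sees a function through its
  differences.\<close>

definition gagliardo_finite :: "real \<Rightarrow> real \<Rightarrow> ('a::euclidean_space \<Rightarrow> real) \<Rightarrow> bool" where
  "gagliardo_finite s p W \<longleftrightarrow> W \<in> borel_measurable borel \<and>
     integrable lborel (\<lambda>z. \<bar>diff_quot s p W z\<bar> powr p)"

lemma measurable_quot [measurable]:
  assumes [measurable]: "W \<in> borel_measurable borel"
  shows "diff_quot s p W \<in> borel_measurable borel" "dual_quot s p W \<in> borel_measurable borel"
  unfolding diff_quot_def[abs_def] dual_quot_def[abs_def] borel_prod[symmetric] by measurable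

lemma diff_quot_powr:
  fixes W :: "'a::euclidean_space \<Rightarrow> real"
  assumes "1 < p"
  shows "\<bar>diff_quot s p W z\<bar> powr p =
     \<bar>W (fst z) - W (snd z)\<bar> powr p / norm (fst z - snd z) powr (real DIM('a) + s * p)"
  using assms by (simp add: diff_quot_def powr_divide powr_powr)

text \<open>Raising to the conjugate exponent turns both \<open>p - 1\<close> and
  \<open>(p - 1) / p\<close> into the exponents of the seminorm, so finite energy of
  \<open>U\<close> is exactly membership of \<open>dual_quot s p U\<close> in the dual
  space.\<close>

lemma dual_quot_powr:
  fixes U :: "'a::euclidean_space \<Rightarrow> real"
  assumes "1 < p"
  shows "\<bar>dual_quot s p U z\<bar> powr (p / (p - 1)) = \<bar>diff_quot s p U z\<bar> powr p"
  using assms by (simp add: diff_quot_powr dual_quot_def powr_divide powr_powr spow_abs)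

text \<open>The kernel exponent splits because \<open>(p - 1) / p + 1 / p = 1\<close>. Reading the
  product measure as \<open>lborel\<close> on pairs makes the translation results applicable to
  pairs.\<close>

lemma frac_plap_pair_quot:
  fixes U \<phi> :: "'a::euclidean_space \<Rightarrow> real"
  assumes "1 < p"
  shows "frac_plap_pair s p U \<phi> = (LINT z|lborel. dual_quot s p U z * diff_quot s p \<phi> z)"
proof -
  let ?q = "real DIM('a) + s * p"
  have q: "?q = ?q * ((p - 1) / p) + ?q / p"
    using assms by (simp add: field_simps)
  have "spow (p - 1) (U (fst z) - U (snd z)) * (\<phi> (fst z) - \<phi> (snd z)) / norm (fst z - snd z) powr ?q
    = dual_quot s p U z * diff_quot s p \<phi> z" for z
    by (subst q, subst powr_add) (simp add: dual_quot_def diff_quot_def)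
  then show ?thesis unfolding frac_plap_pair_def lborel_prod by simp
qed

lemma frac_sobolev_gagliardo_finite:
  assumes "1 < p" "frac_sobolev s p U"
  shows "gagliardo_finite s p U"
proof -
  have [measurable]: "U \<in> borel_measurable borel"
    and fin: "(\<integral>\<^sup>+ z. ennreal (\<bar>diff_quot s p U z\<bar> powr p) \<partial>lborel) < \<infinity>"
    using assms by (auto simp: frac_sobolev_def diff_quot_powr lborel_prod)
  have "integrable lborel (\<lambda>z. \<bar>diff_quot s p U z\<bar> powr p)"
    by (rule integrableI_nonneg) (use fin in auto)
  then show ?thesis by (simp add: gagliardo_finite_def)
qed

lemma integrable_quot_mult:
  assumes p: "1 < p" and "gagliardo_finite s p U" "gagliardo_finite s p \<phi>"
  shows "integrable lborel (\<lambda>z. dual_quot s p U z * diff_quot s p \<phi> z)"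
  using assms by (intro integrable_mult_conjugate[OF p]) (auto simp: gagliardo_finite_def dual_quot_powr)

lemma integral_lborel_reflect:
  fixes g :: "'a::euclidean_space \<Rightarrow> real"
  assumes [measurable]: "g \<in> borel_measurable borel"
  shows "(LINT y|lborel. g (x - y)) = (LINT y|lborel. g y)"
proof -
  have "distr lborel borel (\<lambda>y. x - y) = (lborel :: 'a measure)"
    using lborel_affine[of "-1" x] by (simp add: density_1)
  then have "(LINT y|lborel. g y) = (LINT y|distr lborel borel (\<lambda>y. x - y). g y)" by simp
  also have "\<dots> = (LINT y|lborel. g (x - y))" by (subst integral_distr) auto
  finally show ?thesis by simp
qed

text \<open>Mollifying \<open>W\<close> at a scale below its distance to the complement yields
  admissible test functions; both sides of the equation then pass to the limit as shifted
  pairings.\<close>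

lemma weak_equation_compact_support:
  fixes \<Omega> :: "'a::euclidean_space set" and U W f :: "'a \<Rightarrow> real"
  assumes p: "1 < p" and om: "open \<Omega>" "bounded \<Omega>"
    and eq: "\<And>\<phi>. test_fun \<Omega> \<phi> \<Longrightarrow> frac_plap_pair s p U \<phi> = (LINT x:\<Omega>|lborel. f x * \<phi> x)"
    and U: "gagliardo_finite s p U" and f: "set_integrable lborel \<Omega> f"
    and W: "gagliardo_finite s p W" and M: "\<And>x. \<bar>W x\<bar> \<le> M"
    and \<eta>: "\<eta> > 0" and supp: "\<And>x. W x \<noteq> 0 \<Longrightarrow> 2 * \<eta> \<le> infdist x (- \<Omega>)"
  shows "frac_plap_pair s p U W = (LINT x:\<Omega>|lborel. f x * W x)"
proof -
  have [measurable]: "U \<in> borel_measurable borel" "W \<in> borel_measurable borel"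
    using U W by (auto simp: gagliardo_finite_def)
  have inO: "x \<in> \<Omega>" if "infdist x (- \<Omega>) > 0" for x
    using that by (metis ComplI infdist_zero less_irrefl)
  have W0: "W x = 0" if "x \<notin> \<Omega>" for x
    using supp[of x] inO[of x] that \<eta> by force
  have [measurable]: "\<Omega> \<in> sets borel" using om by simp
  have Wi: "integrable lborel W"
  proof (rule Bochner_Integration.integrable_bound)
    have "emeasure lborel \<Omega> < \<infinity>" using om(2) by (rule emeasure_bounded_finite)
    then show "integrable lborel (\<lambda>x. M * indicator \<Omega> x :: real)" by (simp add: integrable_indicator_iff)
    show "AE x in lborel. norm (W x) \<le> norm (M * indicator \<Omega> x :: real)"
    proof (rule AE_I2)
      fix x show "norm (W x) \<le> norm (M * indicator \<Omega> x :: real)"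
        using M[of x] W0[of x] by (cases "x \<in> \<Omega>") auto
    qed
  qed simp
  \<comment> \<open>The support of \<open>W\<close> keeps distance \<open>2 \<eta>\<close> from the
    complement. A radius of at most \<open>\<eta>\<close> leaves distance \<open>\<eta>\<close>
    after mollification.\<close>
  define r where "r n = \<eta> / real (Suc n)" for n
  have r: "r n > 0" "r n \<le> \<eta>" for n
    using \<eta> by (auto simp: r_def field_simps)
  have rlim: "r \<longlonglongrightarrow> 0" unfolding r_def by (rule lim_const_over_n[THEN LIMSEQ_Suc])
  have "\<exists>\<rho> :: 'a \<Rightarrow> real. smooth_fun \<rho> \<and> (\<forall>x. \<rho> x \<ge> 0) \<and> (\<forall>x. norm x \<ge> r n \<longrightarrow> \<rho> x = 0) \<and> integrable lborel \<rho> \<and> (LINT x|lborel. \<rho> x) = 1" for n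
    using exists_mollifier[OF r(1)[of n]] by metis
  then obtain \<rho> :: "nat \<Rightarrow> 'a \<Rightarrow> real" where sm: "\<And>n. smooth_fun (\<rho> n)" and \<rho>: "\<And>n. integrable lborel (\<rho> n)" "\<And>n x. \<rho> n x \<ge> 0" "\<And>n. (LINT x|lborel. \<rho> n x) = 1"
    and \<rho>0: "\<And>n x. norm x \<ge> r n \<Longrightarrow> \<rho> n x = 0"
    by metis
  have [measurable]: "\<rho> n \<in> borel_measurable borel" for n using \<rho>(1)[of n] by auto
  define \<phi> where "\<phi> n x = (LINT y|lborel. \<rho> n (x - y) * W y)" for n x
  have \<phi>: "\<phi> n x = (LINT h|lborel. \<rho> n h * W (x - h))" for n x
    using integral_lborel_reflect[of "\<lambda>h. \<rho> n h * W (x - h)" x] by (simp add: \<phi>_def)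
  have \<phi>i: "integrable lborel (\<lambda>h. \<rho> n h * W (x - h))" for n x
  proof (rule Bochner_Integration.integrable_bound)
    show "integrable lborel (\<lambda>h. M * \<rho> n h)" using \<rho> by simp
    have "M \<ge> 0" using M[of 0] by simp
    then show "AE h in lborel. norm (\<rho> n h * W (x - h)) \<le> norm (M * \<rho> n h)"
      using M by (intro AE_I2) (auto simp: abs_mult mult.commute[of M] intro!: mult_left_mono)
  qed simp
  have test: "test_fun \<Omega> (\<phi> n)" for n
  proof -
    let ?K = "{x. infdist x (- \<Omega>) \<ge> \<eta>}"
    have "smooth_fun (\<phi> n)" unfolding \<phi>_def
      by (rule smooth_fun_convolution[where R = "r n", OF sm _ Wi]) (use \<rho>0 in auto)
    moreover have "{x. \<phi> n x \<noteq> 0} \<subseteq> ?K"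
    proof clarify
      fix x assume nz: "\<phi> n x \<noteq> 0"
      have "\<exists>y. \<rho> n (x - y) * W y \<noteq> 0"
      proof (rule ccontr)
        assume "\<not> ?thesis"
        then have "(\<lambda>y. \<rho> n (x - y) * W y) = (\<lambda>_. 0)" by auto
        then show False using nz by (simp add: \<phi>_def)
      qed
      then obtain y where y: "\<rho> n (x - y) \<noteq> 0" "W y \<noteq> 0" by auto
      have "dist x y < \<eta>" using \<rho>0[of n "x - y"] y(1) r(2)[of n] by (force simp: dist_norm)
      moreover have "infdist y (- \<Omega>) \<le> infdist x (- \<Omega>) + dist x y"
        using infdist_triangle_abs[of x "- \<Omega>" y] by simp
      ultimately show "\<eta> \<le> infdist x (- \<Omega>)" using supp[OF y(2)] by simp
    qed
    moreover have "closed ?K" by (intro closed_Collect_le continuous_intros)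
    moreover have "?K \<subseteq> \<Omega>" using inO \<eta> by force
    ultimately have "closure {x. \<phi> n x \<noteq> 0} \<subseteq> \<Omega>" "smooth_fun (\<phi> n)"
      by (meson closure_minimal subset_trans)+
    moreover from this have "compact (closure {x. \<phi> n x \<noteq> 0})"
      using om(2) bounded_subset compact_eq_bounded_closed closed_closure by blast
    ultimately show ?thesis by (simp add: test_fun_def)
  qed
  have "(\<lambda>n. frac_plap_pair s p U (\<phi> n)) \<longlonglongrightarrow> frac_plap_pair s p U W"
  proof -
    \<comment> \<open>A diagonal shift does not change \<open>x - y\<close>, so the weight is
      constant under the mollifier integral and comes out of it.\<close>
    have dq: "diff_quot s p (\<phi> n) z = (LINT h|lborel. \<rho> n h * diff_quot s p W (z - (h, h)))" for n z
    proof -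
      let ?c = "norm (fst z - snd z) powr ((real DIM('a) + s * p) / p)"
      have "(\<lambda>h. \<rho> n h * diff_quot s p W (z - (h, h))) = (\<lambda>h. (\<rho> n h * W (fst z - h) - \<rho> n h * W (snd z - h)) / ?c)"
        by (simp add: diff_quot_def right_diff_distrib)
      then show ?thesis using \<phi>i[of n "fst z"] \<phi>i[of n "snd z"] by (simp add: diff_quot_def \<phi>)
    qed
    note gU = U[unfolded gagliardo_finite_def] and gW = W[unfolded gagliardo_finite_def]
    have GWt: "integrable lborel (\<lambda>z. \<bar>diff_quot s p W (z - h)\<bar> powr p)"
      "(LINT z|lborel. \<bar>diff_quot s p W (z - h)\<bar> powr p) = (LINT z|lborel. \<bar>diff_quot s p W z\<bar> powr p)" for h
      using integrable_lborel_translate[OF conjunct2[OF gW], of h]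
        integral_lborel_translate[of "\<lambda>z. \<bar>diff_quot s p W z\<bar> powr p" h] by auto
    have FU: "integrable lborel (\<lambda>z. \<bar>dual_quot s p U z\<bar> powr (p / (p - 1)))"
      using gU p by (simp add: dual_quot_powr)
    have int: "integrable lborel (\<lambda>z. dual_quot s p U z * diff_quot s p W (z - h))" for h
      by (rule integrable_mult_conjugate[OF p _ _ FU GWt(1)]) measurable
    have "(\<lambda>n. LINT z|lborel. dual_quot s p U z * (LINT h|lborel. \<rho> n h * diff_quot s p W (z - (h, h))))
        \<longlonglongrightarrow> (LINT z|lborel. dual_quot s p U z * diff_quot s p W z)"
    proof (rule mollified_pairing_tendsto[OF _ _ _ _ int _ _ \<rho> \<rho>0 rlim])
      show "(LINT z|lborel. \<bar>dual_quot s p U z * diff_quot s p W (z - h)\<bar>)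
         \<le> (LINT z|lborel. \<bar>dual_quot s p U z\<bar> powr (p / (p - 1))) + (LINT z|lborel. \<bar>diff_quot s p W z\<bar> powr p)" for h
      proof -
        have "(LINT z|lborel. \<bar>dual_quot s p U z * diff_quot s p W (z - h)\<bar>)
          \<le> (LINT z|lborel. \<bar>dual_quot s p U z\<bar> powr (p / (p - 1)) + \<bar>diff_quot s p W (z - h)\<bar> powr p)"
          using FU GWt(1)[of h] young_powr_eps[of 1 p] p by (intro integral_mono integrable_abs int) auto
        then show ?thesis using FU GWt[of h] by simp
      qed
      show "(\<lambda>n. LINT z|lborel. dual_quot s p U z * diff_quot s p W (z - h n)) \<longlonglongrightarrow> (LINT z|lborel. dual_quot s p U z * diff_quot s p W z)"
        if "h \<longlonglongrightarrow> 0" for h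
        by (rule translate_pairing_tendsto[OF p _ _ FU conjunct2[OF gW] that]) measurable
    qed (auto intro!: continuous_intros simp: zero_prod_def)
    then show ?thesis using p by (simp add: frac_plap_pair_quot dq)
  qed
  moreover have "(\<lambda>n. LINT x:\<Omega>|lborel. f x * \<phi> n x) \<longlonglongrightarrow> (LINT x:\<Omega>|lborel. f x * W x)"
  proof -
    define f1 where "f1 x = indicator \<Omega> x * f x" for x
    have f1: "integrable lborel f1" using f by (simp add: set_integrable_def f1_def[abs_def])
    then have [measurable]: "f1 \<in> borel_measurable borel" by auto
    have "(\<lambda>n. LINT x|lborel. f1 x * (LINT h|lborel. \<rho> n h * W (x - h))) \<longlonglongrightarrow> (LINT x|lborel. f1 x * W x)"
      by (rule mollified_pairing_tendsto[where L = "\<lambda>h. h", OF _ _ _ _ bounded_translate_pairing[OF f1 _ M] \<rho> \<rho>0 rlim])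
        (auto intro!: continuous_intros)
    then show ?thesis by (simp add: set_lebesgue_integral_def f1_def mult.assoc \<phi>[symmetric])
  qed
  ultimately show ?thesis using eq[OF test] LIMSEQ_unique by simp
qed

section \<open>Cutoff near the boundary and its convergence in energy\<close>

text \<open>For positive \<open>n\<close> a ramp between the distances \<open>1 / n\<close> and
  \<open>2 / n\<close>. Subtracting 1 keeps the support away from the complement, which leaves room
  for mollification.\<close>

definition boundary_cutoff :: "'a::euclidean_space set \<Rightarrow> nat \<Rightarrow> 'a \<Rightarrow> real" where
  "boundary_cutoff \<Omega> n x = max 0 (min 1 (real n * infdist x (- \<Omega>) - 1))"

lemma boundary_cutoff_bounds: "0 \<le> boundary_cutoff \<Omega> n x" "boundary_cutoff \<Omega> n x \<le> 1"
  by (auto simp: boundary_cutoff_def)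

lemma boundary_cutoff_measurable [measurable]: "boundary_cutoff \<Omega> n \<in> borel_measurable borel"
  unfolding boundary_cutoff_def[abs_def]
  by (intro borel_measurable_continuous_onI continuous_intros)

lemma boundary_cutoff_tendsto:
  assumes "infdist x (- \<Omega>) > 0"
  shows "(\<lambda>n. boundary_cutoff \<Omega> n x) \<longlonglongrightarrow> 1"
proof (rule tendsto_eventually)
  obtain k where k: "real k * infdist x (- \<Omega>) > 2"
    using reals_Archimedean3[OF assms] by blast
  have "boundary_cutoff \<Omega> n x = 1" if "n \<ge> k" for n
  proof -
    have "real k * infdist x (- \<Omega>) \<le> real n * infdist x (- \<Omega>)"
      using that assms by (intro mult_right_mono) auto
    then show ?thesis using k by (simp add: boundary_cutoff_def)
  qed
  then show "\<forall>\<^sub>F n in sequentially. boundary_cutoff \<Omega> n x = 1"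
    by (auto simp: eventually_sequentially)
qed

text \<open>The bound does not depend on \<open>n\<close>, so it can serve for domination.\<close>
lemma boundary_cutoff_osc:
  assumes d: "infdist x (- \<Omega>) > 0"
  shows "\<bar>boundary_cutoff \<Omega> n x - boundary_cutoff \<Omega> n y\<bar> \<le> min 1 (4 * norm (x - y) / infdist x (- \<Omega>))"
proof -
  define a where "a = infdist x (- \<Omega>)"
  define b where "b = infdist y (- \<Omega>)"
  define t where "t = norm (x - y)"
  define A where "A = boundary_cutoff \<Omega> n x"
  define B where "B = boundary_cutoff \<Omega> n y"
  have AB: "0 \<le> A" "A \<le> 1" "0 \<le> B" "B \<le> 1" by (auto simp: A_def B_def boundary_cutoff_bounds)
  have ab: "\<bar>a - b\<bar> \<le> t" using infdist_triangle_abs[of x "- \<Omega>" y] by (simp add: a_def b_def t_def dist_norm)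
  have a: "a > 0" using d by (simp add: a_def)
  have t0: "t \<ge> 0" by (simp add: t_def)
  have le1: "\<bar>A - B\<bar> \<le> 1" using AB by auto
  have "\<bar>A - B\<bar> * a \<le> 4 * t"
  \<comment> \<open>If \<open>n a \<le> 4\<close>, the Lipschitz constant \<open>n\<close> is at
    most \<open>4 / a\<close>. Otherwise the cutoff is 1 at \<open>x\<close>, and it can differ at
    \<open>y\<close> only if \<open>n b < 2\<close>; then \<open>b < a / 2\<close>, so the two
    points are far apart relative to \<open>a\<close>.\<close>
  proof (cases "real n * a \<le> 4")
    case True
    have "\<bar>A - B\<bar> \<le> \<bar>real n * a - real n * b\<bar>"
      by (auto simp: A_def B_def boundary_cutoff_def a_def b_def)
    also have "\<dots> = real n * \<bar>a - b\<bar>" by (simp add: abs_mult flip: right_diff_distrib)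
    also have "\<dots> \<le> real n * t" using ab by (intro mult_left_mono) auto
    finally have "\<bar>A - B\<bar> * a \<le> real n * t * a" using a by (intro mult_right_mono) auto
    also have "\<dots> = (real n * a) * t" by simp
    also have "\<dots> \<le> 4 * t" using True t0 by (rule mult_right_mono)
    finally show ?thesis .
  next
    case False
    then have A1: "A = 1" by (simp add: A_def boundary_cutoff_def a_def)
    show ?thesis
    proof (cases "real n * b \<ge> 2")
      case True
      then have "B = 1" by (simp add: B_def boundary_cutoff_def b_def)
      then show ?thesis using A1 t0 by simp
    next
      case b2: False
      have "real n * (2 * b) < real n * a" using False b2 by simp
      then have "2 * b < a" by (simp add: mult_less_cancel_left)
      then have "a \<le> 4 * t" using ab a by linarith
      moreover have "\<bar>A - B\<bar> * a \<le> 1 * a" using le1 a by (intro mult_right_mono) auto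
      ultimately show ?thesis by simp
    qed
  qed
  then have "\<bar>A - B\<bar> \<le> 4 * t / a" using a by (simp add: field_simps)
  then show ?thesis using le1 by (simp add: A_def B_def t_def a_def)
qed

lemma abs_add_powr_le:
  fixes a b p :: real
  assumes "0 < p"
  shows "\<bar>a + b\<bar> powr p \<le> 2 powr p * (\<bar>a\<bar> powr p + \<bar>b\<bar> powr p)"
proof -
  have "\<bar>a + b\<bar> powr p \<le> (2 * max \<bar>a\<bar> \<bar>b\<bar>) powr p"
    using assms by (intro powr_mono2) auto
  also have "\<dots> = 2 powr p * max \<bar>a\<bar> \<bar>b\<bar> powr p" by (simp add: powr_mult)
  also have "max \<bar>a\<bar> \<bar>b\<bar> powr p \<le> \<bar>a\<bar> powr p + \<bar>b\<bar> powr p"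
    by (simp add: max_def)
  finally show ?thesis by simp
qed

text \<open>The complement is nonempty by boundedness. This matters for the positivity of
  \<open>infdist\<close>, which is 0 by convention for the empty set.\<close>

lemma bounded_smooth_domainD:
  fixes \<Omega> :: "'a::euclidean_space set"
  assumes "bounded_smooth_domain \<Omega>"
  shows "open \<Omega>" "bounded \<Omega>" "- \<Omega> \<noteq> {}" "x \<in> \<Omega> \<Longrightarrow> infdist x (- \<Omega>) > 0"
proof -
  show o: "open \<Omega>" and b: "bounded \<Omega>" using assms by (auto simp: bounded_smooth_domain_def)
  show ne: "- \<Omega> \<noteq> {}" using b not_bounded_UNIV by (metis compl_bot_eq double_compl)
  show "x \<in> \<Omega> \<Longrightarrow> infdist x (- \<Omega>) > 0"
    using o ne infdist_pos_not_in_closed[of "- \<Omega>" x] by auto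
qed

text \<open>For fixed \<open>x\<close> in \<Omega>, the \<open>y\<close>-integral of the truncated
  kernel is at most \<open>C\<close> times the distance to the power \<open>- s p\<close>, and
  \<open>c\<close> times that power is at most the exterior integral of the full kernel. Their ratio
  \<open>C / c\<close> bounds the whole by the seminorm. The integrand is the majorant for the
  cutoff.\<close>

lemma hardy_type_integrable:
  fixes \<Omega> :: "'a::euclidean_space set" and W :: "'a \<Rightarrow> real"
  assumes dom: "bounded_smooth_domain \<Omega>" and p: "1 < p" and s: "0 < s" "s < 1"
    and W: "gagliardo_finite s p W" and W0: "\<And>x. x \<notin> \<Omega> \<Longrightarrow> W x = 0"
  shows "integrable lborel (\<lambda>z. \<bar>W (fst z)\<bar> powr p * (min 1 (4 * norm (fst z - snd z) / infdist (fst z) (- \<Omega>)) powr p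
       / norm (fst z - snd z) powr (real DIM('a) + s * p)))"
proof -
  let ?q = "real DIM('a) + s * p" and ?d = "\<lambda>x. infdist x (- \<Omega>)"
  let ?K = "\<lambda>x y. min 1 (4 * norm (x - y) / ?d x) powr p / norm (x - y) powr ?q"
  note om = bounded_smooth_domainD(1)[OF dom] and dpos = bounded_smooth_domainD(4)[OF dom]
  have [measurable]: "\<Omega> \<in> sets borel" using om by simp
  have [measurable]: "W \<in> borel_measurable borel" using W by (simp add: gagliardo_finite_def)
  have [measurable]: "?d \<in> borel_measurable borel"
    by (intro borel_measurable_continuous_onI continuous_intros)
  have sp: "s * p > 0" using s p by simp
  obtain c where c: "c > 0" and ext: "\<And>x. x \<in> \<Omega> \<Longrightarrow> ennreal (c * ?d x powr (- (s * p)))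
     \<le> (\<integral>\<^sup>+y. ennreal (1 / norm (x - y) powr ?q) * indicator (- \<Omega>) y \<partial>lborel)"
    using bounded_smooth_domain_exterior_kernel[OF dom refl sp] by blast
  obtain C where C: "C \<ge> 0" and ker: "\<And>a (x :: 'a). a > 0 \<Longrightarrow>
    (\<integral>\<^sup>+y. ennreal (min 1 (4 * norm (x - y) / a) powr p / norm (x - y) powr ?q) \<partial>lborel) \<le> ennreal (C * a powr (- (s * p)))"
    using nn_integral_truncated_kernel[OF s p] by blast
  have meas: "(\<lambda>z. \<bar>W (fst z)\<bar> powr p * ?K (fst z) (snd z)) \<in> borel_measurable (lborel \<Otimes>\<^sub>M lborel)"
    by measurable
  have "(\<integral>\<^sup>+z. ennreal (\<bar>W (fst z)\<bar> powr p * ?K (fst z) (snd z)) \<partial>(lborel \<Otimes>\<^sub>M lborel))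
     = (\<integral>\<^sup>+x. \<integral>\<^sup>+y. ennreal (\<bar>W x\<bar> powr p * ?K x y) \<partial>lborel \<partial>lborel)"
    using meas by (subst lborel.nn_integral_fst[symmetric]) simp_all
  also have "\<dots> \<le> (\<integral>\<^sup>+x. \<integral>\<^sup>+y. ennreal (C / c) * ennreal (\<bar>diff_quot s p W (x, y)\<bar> powr p) \<partial>lborel \<partial>lborel)"
  proof (rule nn_integral_mono)
    fix x
    show "(\<integral>\<^sup>+y. ennreal (\<bar>W x\<bar> powr p * ?K x y) \<partial>lborel)
        \<le> (\<integral>\<^sup>+y. ennreal (C / c) * ennreal (\<bar>diff_quot s p W (x, y)\<bar> powr p) \<partial>lborel)"
    proof (cases "x \<in> \<Omega>")
      case False
      then show ?thesis using W0 by simp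
    next
      case True
      have "(\<integral>\<^sup>+y. ennreal (\<bar>W x\<bar> powr p * ?K x y) \<partial>lborel) = ennreal (\<bar>W x\<bar> powr p) * (\<integral>\<^sup>+y. ennreal (?K x y) \<partial>lborel)"
      proof -
        have "ennreal (\<bar>W x\<bar> powr p * ?K x y) = ennreal (\<bar>W x\<bar> powr p) * ennreal (?K x y)" for y
          by (rule ennreal_mult) auto
        then show ?thesis by (simp only:) (rule nn_integral_cmult, measurable)
      qed
      also have "\<dots> \<le> ennreal (\<bar>W x\<bar> powr p) * ennreal (C * ?d x powr (- (s * p)))"
        by (intro mult_left_mono ker dpos True) auto
      also have "\<dots> = ennreal (\<bar>W x\<bar> powr p) * (ennreal (C / c) * ennreal (c * ?d x powr (- (s * p))))"
        using c C by (simp add: ennreal_mult[symmetric])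
      also have "\<dots> \<le> ennreal (\<bar>W x\<bar> powr p) * (ennreal (C / c) * (\<integral>\<^sup>+y. ennreal (1 / norm (x - y) powr ?q) * indicator (- \<Omega>) y \<partial>lborel))"
        by (intro mult_left_mono ext True) auto
      also have "\<dots> = (\<integral>\<^sup>+y. ennreal (\<bar>W x\<bar> powr p) * (ennreal (C / c) * (ennreal (1 / norm (x - y) powr ?q) * indicator (- \<Omega>) y)) \<partial>lborel)"
        by (simp add: nn_integral_cmult)
      also have "\<dots> \<le> (\<integral>\<^sup>+y. ennreal (C / c) * ennreal (\<bar>diff_quot s p W (x, y)\<bar> powr p) \<partial>lborel)"
      proof (rule nn_integral_mono)
        fix y
        show "ennreal (\<bar>W x\<bar> powr p) * (ennreal (C / c) * (ennreal (1 / norm (x - y) powr ?q) * indicator (- \<Omega>) y))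
           \<le> ennreal (C / c) * ennreal (\<bar>diff_quot s p W (x, y)\<bar> powr p)"
        \<comment> \<open>Off \<Omega> the value \<open>W y\<close> is 0, so the seminorm integrand
          is exactly \<open>|W x| powr p\<close> times the kernel; on \<Omega> the left side
          vanishes.\<close>
        proof (cases "y \<in> \<Omega>")
          case False
          then have "\<bar>diff_quot s p W (x, y)\<bar> powr p = \<bar>W x\<bar> powr p * (1 / norm (x - y) powr ?q)"
            using W0 p by (simp add: diff_quot_powr)
          then show ?thesis using False c C
            by (simp add: ennreal_mult[symmetric] mult_ac del: times_divide_eq_right times_divide_eq_left)
        qed simp
      qed
      finally show ?thesis .
    qed
  qed
  also have "\<dots> = ennreal (C / c) * (\<integral>\<^sup>+z. ennreal (\<bar>diff_quot s p W z\<bar> powr p) \<partial>(lborel \<Otimes>\<^sub>M lborel))"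
  proof -
    have [measurable]: "diff_quot s p W \<in> borel_measurable (lborel \<Otimes>\<^sub>M lborel)" by (simp add: lborel_prod)
    show ?thesis
      by (subst lborel.nn_integral_fst[symmetric], measurable, subst nn_integral_cmult[symmetric], measurable)
         (subst nn_integral_cmult, measurable)
  qed
  also have "\<dots> < \<infinity>"
    using W by (simp add: gagliardo_finite_def lborel_prod integrable_iff_bounded ennreal_mult_less_top)
  finally show ?thesis using meas unfolding lborel_prod by (intro integrableI_nonneg) auto
qed

text \<open>The cut-off functions are dominated in energy by a majorant independent of
  \<open>n\<close>, and in the source term by \<open>M |f|\<close>, so dominated convergence extends
  the equation up to the boundary.\<close>

lemma weak_equation_bounded:
  fixes \<Omega> :: "'a::euclidean_space set" and U W f :: "'a \<Rightarrow> real"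
  assumes dom: "bounded_smooth_domain \<Omega>" and p: "1 < p" and s: "0 < s" "s < 1"
    and eq: "\<And>\<phi>. test_fun \<Omega> \<phi> \<Longrightarrow> frac_plap_pair s p U \<phi> = (LINT x:\<Omega>|lborel. f x * \<phi> x)"
    and U: "gagliardo_finite s p U" and f: "set_integrable lborel \<Omega> f"
    and W: "gagliardo_finite s p W" and M: "\<And>x. \<bar>W x\<bar> \<le> M" and W0: "\<And>x. x \<notin> \<Omega> \<Longrightarrow> W x = 0"
  shows "frac_plap_pair s p U W = (LINT x:\<Omega>|lborel. f x * W x)"
proof -
  let ?q = "real DIM('a) + s * p" and ?d = "\<lambda>x. infdist x (- \<Omega>)"
  note om = bounded_smooth_domainD(1,2)[OF dom] and dpos = bounded_smooth_domainD(4)[OF dom]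
  have [measurable]: "\<Omega> \<in> sets borel" using om by simp
  have [measurable]: "U \<in> borel_measurable borel" "W \<in> borel_measurable borel"
    using U W by (auto simp: gagliardo_finite_def)
  have gU: "integrable lborel (\<lambda>z. \<bar>diff_quot s p U z\<bar> powr p)"
    and gW: "integrable lborel (\<lambda>z. \<bar>diff_quot s p W z\<bar> powr p)"
    using U W by (auto simp: gagliardo_finite_def)
  define E where "E z = \<bar>W (fst z)\<bar> powr p * (min 1 (4 * norm (fst z - snd z) / ?d (fst z)) powr p
       / norm (fst z - snd z) powr ?q)" for z :: "'a \<times> 'a"
  have E: "integrable lborel E" unfolding E_def by (rule hardy_type_integrable[OF dom p s W W0])
  define V where "V n x = boundary_cutoff \<Omega> (Suc n) x * W x" for n x
  have Vm [measurable]: "V n \<in> borel_measurable borel" for n unfolding V_def[abs_def] by measurable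
  have VM: "\<bar>V n x\<bar> \<le> M" for n x
  proof -
    have "\<bar>V n x\<bar> \<le> 1 * \<bar>W x\<bar>"
      using boundary_cutoff_bounds[of \<Omega> "Suc n" x] unfolding V_def abs_mult by (intro mult_right_mono) auto
    then show ?thesis using M[of x] by simp
  qed
  have bound: "\<bar>diff_quot s p (V n) z\<bar> powr p \<le> 2 powr p * (\<bar>diff_quot s p W z\<bar> powr p + E z)" for n z
  proof -
    obtain x y where z: "z = (x, y)" by (cases z)
    let ?h = "boundary_cutoff \<Omega> (Suc n)"
    have 1: "\<bar>?h y * (W x - W y)\<bar> powr p \<le> \<bar>W x - W y\<bar> powr p"
      using boundary_cutoff_bounds[of \<Omega> "Suc n" y] p
      by (intro powr_mono2) (auto simp: abs_mult mult_left_le_one_le)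
    have 2: "\<bar>W x * (?h x - ?h y)\<bar> powr p \<le> \<bar>W x\<bar> powr p * min 1 (4 * norm (x - y) / ?d x) powr p"
    proof (cases "x \<in> \<Omega>")
      case True
      have "\<bar>?h x - ?h y\<bar> powr p \<le> min 1 (4 * norm (x - y) / ?d x) powr p"
        using boundary_cutoff_osc[OF dpos[OF True]] p by (intro powr_mono2) auto
      then show ?thesis by (simp add: abs_mult powr_mult mult_left_mono)
    qed (simp add: W0)
    \<comment> \<open>The oscillation of the cutoff is paired with \<open>W x\<close> rather than
      \<open>W y\<close> because its bound involves the distance at \<open>x\<close>; where that
      bound fails, off \<Omega>, the factor \<open>W x\<close> is 0.\<close>
    have "V n x - V n y = ?h y * (W x - W y) + W x * (?h x - ?h y)"
      by (simp add: V_def algebra_simps)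
    then have "\<bar>V n x - V n y\<bar> powr p \<le> 2 powr p * (\<bar>?h y * (W x - W y)\<bar> powr p + \<bar>W x * (?h x - ?h y)\<bar> powr p)"
      using abs_add_powr_le[of p] p by simp
    also have "\<dots> \<le> 2 powr p * (\<bar>W x - W y\<bar> powr p + \<bar>W x\<bar> powr p * min 1 (4 * norm (x - y) / ?d x) powr p)"
      using 1 2 by (intro mult_left_mono add_mono) auto
    finally have "\<bar>V n x - V n y\<bar> powr p / norm (x - y) powr ?q
       \<le> 2 powr p * (\<bar>W x - W y\<bar> powr p + \<bar>W x\<bar> powr p * min 1 (4 * norm (x - y) / ?d x) powr p) / norm (x - y) powr ?q"
      by (rule divide_right_mono) simp
    then show ?thesis by (simp add: diff_quot_powr[OF p] z E_def add_divide_distrib distrib_left)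
  qed
  have gV: "gagliardo_finite s p (V n)" for n
    unfolding gagliardo_finite_def
  proof
    show "integrable lborel (\<lambda>z. \<bar>diff_quot s p (V n) z\<bar> powr p)"
    proof (rule Bochner_Integration.integrable_bound)
      show "integrable lborel (\<lambda>z. 2 powr p * (\<bar>diff_quot s p W z\<bar> powr p + E z))" using gW E by simp
      show "AE z in lborel. norm (\<bar>diff_quot s p (V n) z\<bar> powr p) \<le> norm (2 powr p * (\<bar>diff_quot s p W z\<bar> powr p + E z))"
      proof (rule AE_I2)
        fix z
        show "norm (\<bar>diff_quot s p (V n) z\<bar> powr p) \<le> norm (2 powr p * (\<bar>diff_quot s p W z\<bar> powr p + E z))"
          using bound[of n z] by simp
      qed
    qed measurable
  qed (rule Vm)
  have Vlim: "(\<lambda>n. V n x) \<longlonglongrightarrow> W x" for x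
  proof (cases "x \<in> \<Omega>")
    case True
    have "(\<lambda>n. boundary_cutoff \<Omega> (Suc n) x * W x) \<longlonglongrightarrow> 1 * W x"
      by (intro tendsto_intros boundary_cutoff_tendsto[THEN LIMSEQ_Suc] dpos True)
    then show ?thesis by (simp add: V_def)
  qed (simp add: V_def W0)
  have eqV: "frac_plap_pair s p U (V n) = (LINT x:\<Omega>|lborel. f x * V n x)" for n
  proof (rule weak_equation_compact_support[OF p om(1,2) eq U f gV VM])
    \<comment> \<open>The cutoff with index \<open>Suc n\<close> is supported at distance at least
      \<open>1 / Suc n\<close>, which has to be twice the mollification margin.\<close>
    show "0 < 1 / (2 * real (Suc n))" by simp
    fix x assume "V n x \<noteq> 0"
    then have "boundary_cutoff \<Omega> (Suc n) x \<noteq> 0" by (auto simp: V_def)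
    then have "real (Suc n) * ?d x > 1" by (auto simp: boundary_cutoff_def max_def min_def split: if_splits)
    then show "2 * (1 / (2 * real (Suc n))) \<le> ?d x" by (simp add: field_simps)
  qed
  have "(\<lambda>n. frac_plap_pair s p U (V n)) \<longlonglongrightarrow> frac_plap_pair s p U W"
    unfolding frac_plap_pair_quot[OF p]
  proof (rule integral_dominated_convergence)
    show "integrable lborel (\<lambda>z. \<bar>diff_quot s p U z\<bar> powr p + 2 powr p * (\<bar>diff_quot s p W z\<bar> powr p + E z))"
      using gU gW E by simp
    show "AE z in lborel. (\<lambda>n. dual_quot s p U z * diff_quot s p (V n) z) \<longlonglongrightarrow> dual_quot s p U z * diff_quot s p W z"
      unfolding diff_quot_def divide_inverse by (intro AE_I2 tendsto_intros Vlim)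
    show "AE z in lborel. norm (dual_quot s p U z * diff_quot s p (V n) z)
        \<le> \<bar>diff_quot s p U z\<bar> powr p + 2 powr p * (\<bar>diff_quot s p W z\<bar> powr p + E z)" for n
    proof (rule AE_I2)
      fix z
      show "norm (dual_quot s p U z * diff_quot s p (V n) z)
        \<le> \<bar>diff_quot s p U z\<bar> powr p + 2 powr p * (\<bar>diff_quot s p W z\<bar> powr p + E z)"
        using young_powr_eps[of 1 p "dual_quot s p U z" "diff_quot s p (V n) z"] bound[of n z] p
        by (simp add: dual_quot_powr)
    qed
  qed measurable
  moreover have "(\<lambda>n. LINT x:\<Omega>|lborel. f x * V n x) \<longlonglongrightarrow> (LINT x:\<Omega>|lborel. f x * W x)"
  proof -
    define f1 where "f1 x = indicator \<Omega> x * f x" for x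
    have f1: "integrable lborel f1" using f by (simp add: set_integrable_def f1_def[abs_def])
    then have [measurable]: "f1 \<in> borel_measurable borel" by auto
    have "(\<lambda>n. LINT x|lborel. f1 x * V n x) \<longlonglongrightarrow> (LINT x|lborel. f1 x * W x)"
    proof (rule integral_dominated_convergence)
      show "integrable lborel (\<lambda>x. \<bar>f1 x\<bar> * M)" using f1 by simp
      show "AE x in lborel. norm (f1 x * V n x) \<le> \<bar>f1 x\<bar> * M" for n
        using VM by (intro AE_I2) (auto simp: abs_mult intro!: mult_left_mono)
      show "AE x in lborel. (\<lambda>n. f1 x * V n x) \<longlonglongrightarrow> f1 x * W x"
        by (intro AE_I2 tendsto_intros Vlim)
    qed measurable
    then show ?thesis by (simp add: set_lebesgue_integral_def f1_def mult.assoc)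
  qed
  ultimately show ?thesis using eqV LIMSEQ_unique by simp
qed

section \<open>Accretivity\<close>

lemma spow_strict_mono:
  assumes r: "0 < r" and ab: "a < b"
  shows "spow r a < spow r b"
proof -
  have sg: "spow r x = sgn x * \<bar>x\<bar> powr r" for x :: real
  proof -
    have "spow r x = sgn x * \<bar>spow r x\<bar>"
      by (simp add: spow_def abs_mult mult_ac) (simp add: sgn_real_def)
    then show ?thesis by (simp add: spow_abs)
  qed
  have pos: "x > 0 \<Longrightarrow> spow r x = x powr r" and neg: "x < 0 \<Longrightarrow> spow r x = - ((- x) powr r)" for x :: real
    by (simp_all add: sg)
  have zero: "spow r 0 = 0" by (simp add: spow_def)
  consider "0 < a" | "a = 0" | "a < 0" "b < 0" | "a < 0" "b = 0" | "a < 0" "b > 0" by linarith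
  then show ?thesis
  proof cases
    case 1 then show ?thesis using ab r by (simp add: pos powr_less_mono2)
  next
    case 2 then show ?thesis using ab by (simp add: pos zero)
  next
    case 3 then show ?thesis using ab r by (simp add: neg powr_less_mono2)
  next
    case 4 then show ?thesis by (simp add: neg zero)
  next
    case 5
    then have "spow r a < 0" "0 < spow r b" by (simp_all add: neg pos)
    then show ?thesis by linarith
  qed
qed

text \<open>This identity carries the sign of the difference from the variable of the energy,
  \<open>[u]\<^sup>m\<close>, back to \<open>u\<close> itself.\<close>

lemma sgn_spow_diff:
  assumes "0 < r"
  shows "sgn (spow r a - spow r b) = sgn (a - b)"
  using spow_strict_mono[OF assms, of a b] spow_strict_mono[OF assms, of b a]
  by (cases a b rule: linorder_cases) auto

definition clamp_unit :: "real \<Rightarrow> real" where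
  "clamp_unit t = max (-1) (min 1 t)"

lemma clamp_unit_bound: "\<bar>clamp_unit t\<bar> \<le> 1"
  by (auto simp: clamp_unit_def)

lemma clamp_unit_lipschitz: "\<bar>clamp_unit a - clamp_unit b\<bar> \<le> \<bar>a - b\<bar>"
  by (auto simp: clamp_unit_def max_def min_def)

lemma clamp_unit_mono: "a \<le> b \<Longrightarrow> clamp_unit a \<le> clamp_unit b"
  by (auto simp: clamp_unit_def max_def min_def)

lemma clamp_unit_measurable [measurable]: "clamp_unit \<in> borel_measurable borel"
  unfolding clamp_unit_def[abs_def] by measurable

lemma clamp_unit_tendsto_sgn: "(\<lambda>n. clamp_unit (real n * t)) \<longlonglongrightarrow> sgn t"
proof (cases "t = 0")
  case False
  obtain k where k: "real k * \<bar>t\<bar> > 1" using reals_Archimedean3[of "\<bar>t\<bar>"] False by auto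
  have "clamp_unit (real n * t) = sgn t" if "n \<ge> k" for n
  proof -
    have "real k * \<bar>t\<bar> \<le> real n * \<bar>t\<bar>" using that by (intro mult_right_mono) auto
    then have "real n * \<bar>t\<bar> > 1" using k by linarith
    then show ?thesis using False by (cases "t > 0") (auto simp: clamp_unit_def)
  qed
  then show ?thesis by (intro tendsto_eventually) (auto simp: eventually_sequentially)
qed (simp add: clamp_unit_def)

text \<open>By Fubini the pairs with an exceptional coordinate form a null set, so changing a
  function on a null set does not affect its difference quotients almost everywhere.\<close>

lemma AE_lborel_pair:
  assumes AE: "AE x in (lborel :: 'a::euclidean_space measure). P x" and [measurable]: "Measurable.pred borel P"
  shows "AE z in (lborel :: ('a \<times> 'a) measure). P (fst z) \<and> P (snd z)"
proof -
  have "AE z in (lborel :: 'a measure) \<Otimes>\<^sub>M (lborel :: 'a measure). P (fst z) \<and> P (snd z)"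
  proof (rule lborel_pair.AE_pair_measure)
    show "{z \<in> space (lborel \<Otimes>\<^sub>M lborel). P (fst z) \<and> P (snd z)} \<in> sets ((lborel :: 'a measure) \<Otimes>\<^sub>M (lborel :: 'a measure))"
      by measurable
    show "AE x in lborel. AE y in lborel. P (fst (x, y)) \<and> P (snd (x, y))"
      using AE by eventually_elim (use AE in simp)
  qed
  then show ?thesis unfolding lborel_prod .
qed

text \<open>Two monotonicities meet: \<open>spow (p - 1)\<close> orders the increments of
  \<open>U\<close> and \<open>V\<close>, and the clamp orders the increments of the test function in
  the same way, so the energy integrand is nonnegative almost everywhere.\<close>

lemma clamped_difference_test:
  fixes \<Omega> :: "'a::euclidean_space set" and U V f g :: "'a \<Rightarrow> real" and n :: nat
  assumes dom: "bounded_smooth_domain \<Omega>" and p: "1 < p" and s: "0 < s" "s < 1"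
    and U: "gagliardo_finite s p U" "AE x in lborel. x \<notin> \<Omega> \<longrightarrow> U x = 0"
    and V: "gagliardo_finite s p V" "AE x in lborel. x \<notin> \<Omega> \<longrightarrow> V x = 0"
    and f: "set_integrable lborel \<Omega> f" and g: "set_integrable lborel \<Omega> g"
    and eqU: "\<And>\<phi>. test_fun \<Omega> \<phi> \<Longrightarrow> frac_plap_pair s p U \<phi> = (LINT x:\<Omega>|lborel. f x * \<phi> x)"
    and eqV: "\<And>\<phi>. test_fun \<Omega> \<phi> \<Longrightarrow> frac_plap_pair s p V \<phi> = (LINT x:\<Omega>|lborel. g x * \<phi> x)"
  shows "0 \<le> (LINT x:\<Omega>|lborel. f x * clamp_unit (real n * (U x - V x)))
           - (LINT x:\<Omega>|lborel. g x * clamp_unit (real n * (U x - V x)))"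
proof -
  have [measurable]: "\<Omega> \<in> sets borel" using bounded_smooth_domainD(1)[OF dom] by simp
  have [measurable]: "U \<in> borel_measurable borel" "V \<in> borel_measurable borel"
    using U V by (auto simp: gagliardo_finite_def)
  define T where "T x = clamp_unit (real n * (U x - V x))" for x
  \<comment> \<open>\<open>U\<close> and \<open>V\<close> vanish off \<Omega> only almost
    everywhere, whereas the extended weak equation wants vanishing at every point; the indicator
    repairs this on a null set.\<close>
  define W where "W x = indicator \<Omega> x * T x" for x
  have [measurable]: "T \<in> borel_measurable borel" unfolding T_def[abs_def] by measurable
  have [measurable]: "W \<in> borel_measurable borel" unfolding W_def[abs_def] by measurable
  have "AE x in lborel. W x = T x"
    using U(2) V(2) by eventually_elim (auto simp: W_def T_def clamp_unit_def)
  then have AEW: "AE z in lborel. W (fst z) = T (fst z) \<and> W (snd z) = T (snd z)"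
    by (rule AE_lborel_pair) measurable
  have dT: "\<bar>T x - T y\<bar> \<le> real n * (\<bar>U x - U y\<bar> + \<bar>V x - V y\<bar>)" for x y
  proof -
    have "\<bar>T x - T y\<bar> \<le> \<bar>real n * (U x - V x) - real n * (U y - V y)\<bar>"
      unfolding T_def by (rule clamp_unit_lipschitz)
    also have "\<dots> = real n * \<bar>(U x - U y) - (V x - V y)\<bar>"
    proof -
      have "real n * (U x - V x) - real n * (U y - V y) = real n * ((U x - U y) - (V x - V y))"
        by (simp add: algebra_simps)
      then show ?thesis by (simp only: abs_mult abs_of_nat)
    qed
    also have "\<dots> \<le> real n * (\<bar>U x - U y\<bar> + \<bar>V x - V y\<bar>)"
      by (intro mult_left_mono) auto
    finally show ?thesis .
  qed
  have gW: "gagliardo_finite s p W"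
    unfolding gagliardo_finite_def
  proof
    show "integrable lborel (\<lambda>z. \<bar>diff_quot s p W z\<bar> powr p)"
    proof (rule Bochner_Integration.integrable_bound)
      show "integrable lborel (\<lambda>z. (real n powr p * 2 powr p) * (\<bar>diff_quot s p U z\<bar> powr p + \<bar>diff_quot s p V z\<bar> powr p))"
        using U V by (simp add: gagliardo_finite_def)
      show "AE z in lborel. norm (\<bar>diff_quot s p W z\<bar> powr p)
         \<le> norm ((real n powr p * 2 powr p) * (\<bar>diff_quot s p U z\<bar> powr p + \<bar>diff_quot s p V z\<bar> powr p))"
        using AEW
      proof eventually_elim
        case (elim z)
        let ?a = "\<bar>U (fst z) - U (snd z)\<bar>" and ?b = "\<bar>V (fst z) - V (snd z)\<bar>"
          and ?N = "norm (fst z - snd z) powr (real DIM('a) + s * p)"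
        have "\<bar>W (fst z) - W (snd z)\<bar> powr p \<le> (real n * (?a + ?b)) powr p"
          using dT[of "fst z" "snd z"] elim p by (intro powr_mono2) auto
        also have "\<dots> = real n powr p * \<bar>?a + ?b\<bar> powr p" by (simp add: powr_mult)
        also have "\<dots> \<le> real n powr p * (2 powr p * (?a powr p + ?b powr p))"
          using abs_add_powr_le[of p ?a ?b] p by (intro mult_left_mono) auto
        finally have "\<bar>W (fst z) - W (snd z)\<bar> powr p / ?N \<le> real n powr p * (2 powr p * (?a powr p + ?b powr p)) / ?N"
          by (rule divide_right_mono) simp
        then show ?case by (simp add: diff_quot_powr[OF p] add_divide_distrib distrib_left mult.assoc)
      qed
    qed measurable
  qed simp
  have WM: "\<bar>W x\<bar> \<le> 1" for x using clamp_unit_bound by (auto simp: W_def T_def indicator_def)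
  have W0: "W x = 0" if "x \<notin> \<Omega>" for x using that by (simp add: W_def)
  have "0 \<le> (LINT z|lborel. dual_quot s p U z * diff_quot s p W z - dual_quot s p V z * diff_quot s p W z)"
  proof (rule integral_nonneg_AE)
    show "AE z in lborel. 0 \<le> dual_quot s p U z * diff_quot s p W z - dual_quot s p V z * diff_quot s p W z"
      using AEW
    proof eventually_elim
      case (elim z)
      obtain x y where z: "z = (x, y)" by (cases z)
      define a where "a = U x - U y"
      define b where "b = V x - V y"
      have ab: "a - b = (U x - V x) - (U y - V y)" by (simp add: a_def b_def)
      \<comment> \<open>The sign of \<open>a - b\<close> is the sign of the increment of
        \<open>U - V\<close> between \<open>y\<close> and \<open>x\<close>, hence controls that of
        \<open>T x - T y\<close>.\<close>
      have "0 \<le> (spow (p - 1) a - spow (p - 1) b) * (T x - T y)"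
      proof (cases a b rule: linorder_cases)
        case less
        then have "T x \<le> T y" using ab unfolding T_def by (intro clamp_unit_mono mult_left_mono) auto
        then show ?thesis using spow_strict_mono[OF _ less, of "p - 1"] p by (intro mult_nonpos_nonpos) auto
      next
        case greater
        then have "T y \<le> T x" using ab unfolding T_def by (intro clamp_unit_mono mult_left_mono) auto
        then show ?thesis using spow_strict_mono[OF _ greater, of "p - 1"] p by (intro mult_nonneg_nonneg) auto
      qed simp
      then have "0 \<le> (spow (p - 1) a - spow (p - 1) b) * (T x - T y) /
         (norm (x - y) powr ((real DIM('a) + s * p) * ((p - 1) / p)) * norm (x - y) powr ((real DIM('a) + s * p) / p))"
        by (rule divide_nonneg_nonneg) simp
      moreover have "W x = T x" "W y = T y" using elim by (auto simp: z)
      moreover have "A / N1 * (D / N2) - B / N1 * (D / N2) = (A - B) * D / (N1 * N2)" for A B D N1 N2 :: real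
        by (simp add: left_diff_distrib diff_divide_distrib)
      ultimately show ?case
        by (simp only: z dual_quot_def diff_quot_def a_def b_def fst_conv snd_conv)
    qed
  qed
  also have "\<dots> = frac_plap_pair s p U W - frac_plap_pair s p V W"
    using integrable_quot_mult[OF p U(1) gW] integrable_quot_mult[OF p V(1) gW]
    by (simp add: frac_plap_pair_quot[OF p])
  also have "\<dots> = (LINT x:\<Omega>|lborel. f x * W x) - (LINT x:\<Omega>|lborel. g x * W x)"
    using weak_equation_bounded[OF dom p s eqU U(1) f gW WM W0] weak_equation_bounded[OF dom p s eqV V(1) g gW WM W0]
    by simp
  finally have "0 \<le> (LINT x:\<Omega>|lborel. f x * W x) - (LINT x:\<Omega>|lborel. g x * W x)" .
  moreover have WT: "(LINT x:\<Omega>|lborel. h x * W x) = (LINT x:\<Omega>|lborel. h x * T x)" for h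
    unfolding set_lebesgue_integral_def
    by (rule Bochner_Integration.integral_cong) (auto simp: W_def indicator_def)
  ultimately show ?thesis unfolding WT[of f] WT[of g] T_def by simp
qed

lemma set_integrable_mult_bounded:
  fixes h w :: "'a::euclidean_space \<Rightarrow> real"
  assumes [measurable]: "\<Omega> \<in> sets borel" and h: "set_integrable lborel \<Omega> h"
    and [measurable]: "w \<in> borel_measurable borel" and M: "\<And>x. \<bar>w x\<bar> \<le> M"
  shows "set_integrable lborel \<Omega> (\<lambda>x. h x * w x)"
proof -
  have h': "integrable lborel (\<lambda>x. indicator \<Omega> x * h x)" using h by (simp add: set_integrable_def)
  have "integrable lborel (\<lambda>x. (indicator \<Omega> x * h x) * w (x - 0))"
    by (rule bounded_translate_pairing(1)[OF h' _ M]) measurable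
  then show ?thesis by (simp add: set_integrable_def mult.assoc)
qed

text \<open>As the clamp steepens it tends pointwise to the sign, including the value 0 at 0, and
  \<open>|f - g|\<close> dominates throughout.\<close>

lemma sgn_test:
  fixes \<Omega> :: "'a::euclidean_space set" and u v f g :: "'a \<Rightarrow> real"
  assumes dom: "bounded_smooth_domain \<Omega>" and p: "1 < p" and s: "0 < s" "s < 1" and m: "0 < m"
    and A: "opA s p m \<Omega> u f" "opA s p m \<Omega> v g"
  shows "0 \<le> (LINT x:\<Omega>|lborel. (f x - g x) * sgn (u x - v x))"
proof -
  note A' = A[unfolded opA_def frac_sobolev0_def]
  have [measurable]: "\<Omega> \<in> sets borel" using bounded_smooth_domainD(1)[OF dom] by simp
  have [measurable]: "u \<in> borel_measurable borel" "v \<in> borel_measurable borel"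
    "f \<in> borel_measurable borel" "g \<in> borel_measurable borel" using A' by auto
  have f: "set_integrable lborel \<Omega> f" and g: "set_integrable lborel \<Omega> g" using A' by auto
  let ?U = "\<lambda>x. spow m (u x)" and ?V = "\<lambda>x. spow m (v x)"
  define T where "T n x = clamp_unit (real n * (?U x - ?V x))" for n x
  have [measurable]: "T n \<in> borel_measurable borel" for n unfolding T_def[abs_def] by measurable
  have T1: "\<bar>T n x\<bar> \<le> 1" for n x by (simp add: T_def clamp_unit_bound)
  have nonneg: "0 \<le> (LINT x:\<Omega>|lborel. (f x - g x) * T n x)" for n
  proof -
    have "0 \<le> (LINT x:\<Omega>|lborel. f x * T n x) - (LINT x:\<Omega>|lborel. g x * T n x)"
      unfolding T_def
      by (rule clamped_difference_test[OF dom p s]) (use A' frac_sobolev_gagliardo_finite[OF p] in auto)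
    also have "\<dots> = (LINT x:\<Omega>|lborel. f x * T n x - g x * T n x)"
      by (intro set_integral_diff(2)[symmetric] set_integrable_mult_bounded[where M = 1] f g T1) measurable
    finally show ?thesis by (simp add: left_diff_distrib)
  qed
  have fg: "integrable lborel (\<lambda>x. indicator \<Omega> x * (f x - g x))"
    using set_integral_diff(1)[OF f g] by (simp add: set_integrable_def)
  have "(\<lambda>n. LINT x:\<Omega>|lborel. (f x - g x) * T n x) \<longlonglongrightarrow> (LINT x:\<Omega>|lborel. (f x - g x) * sgn (u x - v x))"
    unfolding set_lebesgue_integral_def real_scaleR_def
  proof (rule integral_dominated_convergence)
    show "integrable lborel (\<lambda>x. \<bar>indicator \<Omega> x * (f x - g x)\<bar>)" using fg by (rule integrable_abs)
    show "AE x in lborel. norm (indicator \<Omega> x * ((f x - g x) * T n x)) \<le> \<bar>indicator \<Omega> x * (f x - g x)\<bar>" for n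
      using T1 by (intro AE_I2) (auto simp: abs_mult mult_left_le indicator_def)
    show "AE x in lborel. (\<lambda>n. indicator \<Omega> x * ((f x - g x) * T n x)) \<longlonglongrightarrow> indicator \<Omega> x * ((f x - g x) * sgn (u x - v x))"
    proof (rule AE_I2)
      fix x
      have "(\<lambda>n. T n x) \<longlonglongrightarrow> sgn (u x - v x)"
        using clamp_unit_tendsto_sgn[of "?U x - ?V x"] unfolding T_def by (simp only: sgn_spow_diff[OF m])
      then show "(\<lambda>n. indicator \<Omega> x * ((f x - g x) * T n x)) \<longlonglongrightarrow> indicator \<Omega> x * ((f x - g x) * sgn (u x - v x))"
        by (intro tendsto_intros)
    qed
  qed measurable
  then show ?thesis by (rule LIMSEQ_le_const) (use nonneg in auto)
qed

theorem theoremA1: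
  fixes \<Omega> :: "(real ^ 'n) set" and p s m :: real
    and u v f g :: "real ^ 'n \<Rightarrow> real"
  assumes "bounded_smooth_domain \<Omega>"
    and "1 < p" and "0 < s" and "s < 1" and "1 < m"
    and "opA s p m \<Omega> u f" and "opA s p m \<Omega> v g"
  shows "(\<forall>t>0. (LINT x:\<Omega>|lborel. \<bar>u x - v x\<bar>)
              \<le> (LINT x:\<Omega>|lborel. \<bar>u x - v x + t * (f x - g x)\<bar>))
       \<and> (\<exists>w. w \<in> borel_measurable lborel \<and> (\<exists>C. AE x in lborel. x \<in> \<Omega> \<longrightarrow> \<bar>w x\<bar> \<le> C)
              \<and> (AE x in lborel. x \<in> \<Omega> \<longrightarrow> w x \<in> sgn_set (u x - v x))
              \<and> (LINT x:\<Omega>|lborel. (f x - g x) * w x) \<ge> 0)"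
proof (intro conjI allI impI)
  \<comment> \<open>The single-valued sign, equal to 0 where \<open>u = v\<close>, is a measurable
    selection of the multivalued one.\<close>
  define w where "w x = sgn (u x - v x)" for x
  have uvfg: "u \<in> borel_measurable borel" "v \<in> borel_measurable borel"
    and ints: "set_integrable lborel \<Omega> u" "set_integrable lborel \<Omega> v" "set_integrable lborel \<Omega> f" "set_integrable lborel \<Omega> g"
    using assms(6,7) by (auto simp: opA_def)
  note [measurable] = uvfg
  have [measurable]: "w \<in> borel_measurable borel" unfolding w_def[abs_def] by measurable
  have [measurable]: "\<Omega> \<in> sets borel" using bounded_smooth_domainD(1)[OF assms(1)] by simp
  have w1: "\<bar>w x\<bar> \<le> 1" for x by (simp add: w_def sgn_real_def)
  have test: "0 \<le> (LINT x:\<Omega>|lborel. (f x - g x) * w x)"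
    unfolding w_def by (rule sgn_test[OF assms(1-4) _ assms(6,7)]) (use assms(5) in simp)
  show "\<exists>w. w \<in> borel_measurable lborel \<and> (\<exists>C. AE x in lborel. x \<in> \<Omega> \<longrightarrow> \<bar>w x\<bar> \<le> C)
              \<and> (AE x in lborel. x \<in> \<Omega> \<longrightarrow> w x \<in> sgn_set (u x - v x))
              \<and> (LINT x:\<Omega>|lborel. (f x - g x) * w x) \<ge> 0"
  proof (intro exI[of _ w] conjI exI[of _ 1] test)
    show "AE x in lborel. x \<in> \<Omega> \<longrightarrow> w x \<in> sgn_set (u x - v x)"
      by (intro AE_I2) (auto simp: w_def sgn_set_def)
  qed (use w1 in auto)
  fix t :: real assume t: "t > 0"
  have uv: "set_integrable lborel \<Omega> (\<lambda>x. u x - v x)" using ints by (intro set_integral_diff) auto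
  have fg: "set_integrable lborel \<Omega> (\<lambda>x. t * (f x - g x))"
    using set_integral_diff(1)[OF ints(3,4)] by simp
  have i1: "set_integrable lborel \<Omega> (\<lambda>x. (u x - v x) * w x)"
    by (rule set_integrable_mult_bounded[OF _ uv _ w1]) measurable
  have i2: "set_integrable lborel \<Omega> (\<lambda>x. t * (f x - g x) * w x)"
    by (rule set_integrable_mult_bounded[OF _ fg _ w1]) measurable
  \<comment> \<open>The sign realises the \<open>L\<^sup>1\<close> norm of \<open>u - v\<close> by
    duality; against any other function, \<open>|w| \<le> 1\<close> gives only an upper bound, which
    is the direction needed at the end.\<close>
  have "(LINT x:\<Omega>|lborel. \<bar>u x - v x\<bar>) = (LINT x:\<Omega>|lborel. (u x - v x) * w x)"
    by (simp add: w_def mult_sgn_abs abs_sgn)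
  also have "\<dots> \<le> (LINT x:\<Omega>|lborel. (u x - v x) * w x) + t * (LINT x:\<Omega>|lborel. (f x - g x) * w x)"
    using t test by simp
  also have "t * (LINT x:\<Omega>|lborel. (f x - g x) * w x) = (LINT x:\<Omega>|lborel. t * (f x - g x) * w x)"
    by (simp add: mult.assoc)
  also have "(LINT x:\<Omega>|lborel. (u x - v x) * w x) + (LINT x:\<Omega>|lborel. t * (f x - g x) * w x)
      = (LINT x:\<Omega>|lborel. (u x - v x) * w x + t * (f x - g x) * w x)"
    by (rule set_integral_add(2)[symmetric, OF i1 i2])
  also have "\<dots> \<le> (LINT x:\<Omega>|lborel. \<bar>u x - v x + t * (f x - g x)\<bar>)"
  proof (rule set_integral_mono)
    show "set_integrable lborel \<Omega> (\<lambda>x. (u x - v x) * w x + t * (f x - g x) * w x)"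
      by (rule set_integral_add(1)[OF i1 i2])
    show "set_integrable lborel \<Omega> (\<lambda>x. \<bar>u x - v x + t * (f x - g x)\<bar>)"
      by (rule set_integrable_abs) (rule set_integral_add(1)[OF uv fg])
    fix x
    have "(u x - v x) * w x + t * (f x - g x) * w x \<le> \<bar>(u x - v x + t * (f x - g x)) * w x\<bar>"
      by (simp add: distrib_right)
    also have "\<dots> \<le> \<bar>u x - v x + t * (f x - g x)\<bar> * 1"
      unfolding abs_mult using w1 by (intro mult_left_mono) auto
    finally show "(u x - v x) * w x + t * (f x - g x) * w x \<le> \<bar>u x - v x + t * (f x - g x)\<bar>" by simp
  qed
  finally show "(LINT x:\<Omega>|lborel. \<bar>u x - v x\<bar>) \<le> (LINT x:\<Omega>|lborel. \<bar>u x - v x + t * (f x - g x)\<bar>)" .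
qed

end
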